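(* Let $\Pi$ be a simply connected $1$-periodic domain with periodic cell $\varpi$ satisfying the standing geometric assumptions and assumption (A) described in the context, and let $\phi:\mathcal D\to\mathcal A=\{1/\rho<|z|<\rho\}$ and $\varphi:\Pi\to\mathbb C$ be the mappings defined in the context. Then the Bergman kernel $K_\Pi$ of $\Pi$ satisfies, for all $z,w\in\Pi$, $$K_\Pi(z,w)=\widetilde K_\Pi(z,w)\,\frac{\pi^3}{4(\log\rho)^2}\,\operatorname{sech}^2\Big(\frac{\pi^2\big(\varphi(z)-\overline{\varphi(w)}\big)}{2\log\rho}\Big),$$ where $$\widetilde K_\Pi(z,w)=e^{i2\pi\left(z-\varphi(z)-\overline w+\overline{\varphi(w)}\right)}\,\phi'(e^{i2\pi z})\,\overline{\phi'(e^{i2\pi w})}.$$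
   Context: Geometry. Identify $\mathbb C\cong\mathbb R^2$. Let $M>0$, $a<b$ be real and let $\varpi\subset\,]0,1[\,\times\,]-M,M[$ be a domain (the periodic cell) whose closure meets the lines $\mathrm{Re}\,z=0$ and $\mathrm{Re}\,z=1$ exactly in $\{0\}\times[a,b]$ and $\{1\}\times[a,b]$; put $J_-=\{0\}\times(a,b)$, $J_+=\{1\}\times(a,b)$. For $m\in\mathbb Z$ let $\varpi_m=\varpi+m$, and let the periodic domain $\Pi$ be the interior of $\bigcup_{m\in\mathbb Z}\mathrm{cl}(\varpi_m)$. It is assumed that $\varpi$ and $\Pi$ are Lipschitz domains with piecewise smooth boundaries ($\partial\varpi$ consists of finitely many curves $\gamma:[0,1]\to\mathbb C$ continuously differentiable on $[0,1]$). Here $\varpi$ (equivalently $\Pi$) is simply connected. Conformal maps. Let $E(z)=e^{i2\pi z}$ and $\mathcal D=\{E(z):z\in\varpi\cup J_+\cup J_-\}$, a doubly connected domain surrounding $0$. Let $\phi$ be a conformal mapping from $\mathcal D$ onto the annulus $\mathcal A=\{z:1/\rho<|z|<\rho\}$, with $\rho>1$ uniquely determined by $\mathcal D$, where $\phi$ takes the inner (outer) boundary component to the inner (outer) boundary component. Let $\mathcal D_|=E(\varpi)=\mathcal D\setminus(0,\infty)$, $\mathcal A_|=\phi(\mathcal D_|)$ and $\Gamma=\phi(\mathcal D\cap(0,\infty))=\phi(E(J_+))=\phi(E(J_-))$. Assumption (A): for some $0<\delta<1$, $\Gamma\subset\{z\in\mathbb C:\delta<\arg z<\pi-\delta\}$.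 Branch of the logarithm on $\mathcal A$: the branch cut is $\Gamma$. With $\varpi_+=\varpi\cap\{\mathrm{Re}\,z\ge 1/2\}$ and $\varpi_-=\varpi\setminus\varpi_+$, $\arg$ is the continuous argument on $\mathcal A_|=\mathcal A\setminus\Gamma$ with values in $[0,3\pi]$ such that near each point of $\Gamma$ one has $\arg z<\pi$ for $z\in\phi(E(\varpi_-))$ and $\arg z>2\pi$ for $z\in\phi(E(\varpi_+))$; thus the limits at $\Gamma$ from the two sides differ by $2\pi$. Put $\log z=\log|z|+i\arg z$. On $\Gamma$ itself the value of $\log$ is taken to be the limit from the $\phi(E(\varpi_-))$ side. With $[x]$ the largest integer $\le x$, define for $z\in\Pi$ $$\varphi(z)=\frac1{i2\pi}\log\big(\phi(e^{i2\pi z})\big)+[\mathrm{Re}\,z].$$ The Bergman kernel $K_\Omega$ of a domain $\Omega\subset\mathbb C$ is the integral kernel, with respect to area measure $dA$, of the orthogonal projection from $L^2(\Omega)$ onto the subspace $A^2(\Omega)$ of analytic functions. $\operatorname{sech}z=2/(e^z+e^{-z})$. *)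

theory Defs
  imports "HOL-Complex_Analysis.Complex_Analysis"
begin

section \<open>Bergman kernels\<close>

text \<open>Area measure on \<open>\<complex>\<close> is \<open>lebesgue :: complex measure\<close>.\<close>

definition L2_on :: "complex set \<Rightarrow> (complex \<Rightarrow> complex) set" where
  "L2_on \<Omega> = {f. f \<in> borel_measurable (lebesgue_on \<Omega>)
                 \<and> integrable (lebesgue_on \<Omega>) (\<lambda>z. (norm (f z))\<^sup>2)}"

definition L2_inner :: "complex set \<Rightarrow> (complex \<Rightarrow> complex) \<Rightarrow> (complex \<Rightarrow> complex) \<Rightarrow> complex" where
  "L2_inner \<Omega> f g = (\<integral>z. f z * cnj (g z) \<partial>lebesgue_on \<Omega>)"

definition bergman_space :: "complex set \<Rightarrow> (complex \<Rightarrow> complex) set" where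
  "bergman_space \<Omega> = {f \<in> L2_on \<Omega>. f holomorphic_on \<Omega>}"

text \<open>\<open>g\<close> is the orthogonal projection of \<open>f\<close> onto the Bergman space.\<close>

definition is_bergman_projection ::
    "complex set \<Rightarrow> (complex \<Rightarrow> complex) \<Rightarrow> (complex \<Rightarrow> complex) \<Rightarrow> bool" where
  "is_bergman_projection \<Omega> f g \<longleftrightarrow>
     g \<in> bergman_space \<Omega> \<and> (\<forall>h \<in> bergman_space \<Omega>. L2_inner \<Omega> (\<lambda>z. f z - g z) h = 0)"

text \<open>The integral formula alone determines \<open>K z\<close> only almost everywhere. The usual
  representative is the one that is antiholomorphic in the second variable; with the first
  conjunct below, \<open>K\<close> is unique on \<open>\<Omega> \<times> \<Omega>\<close>.\<close>

definition is_bergman_kernel :: "complex set \<Rightarrow> (complex \<Rightarrow> complex \<Rightarrow> complex) \<Rightarrow> bool" where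
  "is_bergman_kernel \<Omega> K \<longleftrightarrow>
     (\<forall>z \<in> \<Omega>. (\<lambda>w. cnj (K z w)) \<in> bergman_space \<Omega>) \<and>
     (\<forall>f \<in> L2_on \<Omega>. is_bergman_projection \<Omega> f (\<lambda>z. \<integral>w. K z w * f w \<partial>lebesgue_on \<Omega>))"

definition bergman_kernel :: "complex set \<Rightarrow> complex \<Rightarrow> complex \<Rightarrow> complex" where
  "bergman_kernel \<Omega> = (SOME K. is_bergman_kernel \<Omega> K)"


section \<open>Periodic domains\<close>

text \<open>Near each boundary point \<open>p\<close>, the domain is the epigraph of a Lipschitz function in the
  orthonormal coordinates with origin \<open>p\<close> and axes \<open>c\<close>, \<open>\<i> c\<close>.\<close>

definition lipschitz_domain :: "complex set \<Rightarrow> bool" where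
  "lipschitz_domain \<Omega> \<longleftrightarrow>
     open \<Omega> \<and> connected \<Omega> \<and> \<Omega> \<noteq> {} \<and>
     (\<forall>p \<in> frontier \<Omega>. \<exists>r > 0. \<exists>c L g. norm c = 1 \<and> L-lipschitz_on UNIV (g :: real \<Rightarrow> real) \<and>
        (\<forall>z \<in> ball p r. z \<in> \<Omega> \<longleftrightarrow> g (Re (cnj c * (z - p))) < Im (cnj c * (z - p))))"

text \<open>The family of curves is locally finite. If \<open>\<Omega>\<close> is bounded this means finite; local
  finiteness is the appropriate condition for an unbounded periodic domain.\<close>

definition piecewise_smooth_boundary :: "complex set \<Rightarrow> bool" where
  "piecewise_smooth_boundary \<Omega> \<longleftrightarrow>
     (\<exists>C :: (real \<Rightarrow> complex) set.
        (\<forall>\<gamma> \<in> C. \<gamma> C1_differentiable_on {0..1}) \<and>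
        (\<forall>R. finite {\<gamma> \<in> C. path_image \<gamma> \<inter> cball 0 R \<noteq> {}}) \<and>
        frontier \<Omega> = (\<Union>\<gamma> \<in> C. path_image \<gamma>))"

definition periodic_domain :: "complex set \<Rightarrow> complex set" where
  "periodic_domain \<omega> = interior (\<Union>m::int. closure ((\<lambda>z. z + of_int m) ` \<omega>))"

definition J_minus :: "real \<Rightarrow> real \<Rightarrow> complex set" where
  "J_minus a b = {z. Re z = 0 \<and> a < Im z \<and> Im z < b}"

definition J_plus :: "real \<Rightarrow> real \<Rightarrow> complex set" where
  "J_plus a b = {z. Re z = 1 \<and> a < Im z \<and> Im z < b}"

definition periodic_cell :: "complex set \<Rightarrow> real \<Rightarrow> real \<Rightarrow> real \<Rightarrow> bool" where
  "periodic_cell \<omega> M a b \<longleftrightarrow>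
     0 < M \<and> a < b \<and>
     \<omega> \<subseteq> {z. 0 < Re z \<and> Re z < 1 \<and> - M < Im z \<and> Im z < M} \<and>
     closure \<omega> \<inter> {z. Re z = 0} = {z. Re z = 0 \<and> a \<le> Im z \<and> Im z \<le> b} \<and>
     closure \<omega> \<inter> {z. Re z = 1} = {z. Re z = 1 \<and> a \<le> Im z \<and> Im z \<le> b} \<and>
     lipschitz_domain \<omega> \<and> piecewise_smooth_boundary \<omega> \<and>
     lipschitz_domain (periodic_domain \<omega>) \<and> piecewise_smooth_boundary (periodic_domain \<omega>)"

definition cell_plus :: "complex set \<Rightarrow> complex set" where
  "cell_plus \<omega> = \<omega> \<inter> {z. 1/2 \<le> Re z}"

definition cell_minus :: "complex set \<Rightarrow> complex set" where
  "cell_minus \<omega> = \<omega> - cell_plus \<omega>"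


section \<open>Conformal maps\<close>

definition expE :: "complex \<Rightarrow> complex" where
  "expE z = exp (\<i> * 2 * of_real pi * z)"

definition ring_domain :: "complex set \<Rightarrow> real \<Rightarrow> real \<Rightarrow> complex set" where
  "ring_domain \<omega> a b = expE ` (\<omega> \<union> J_plus a b \<union> J_minus a b)"

definition annulus :: "real \<Rightarrow> complex set" where
  "annulus \<rho> = {z. 1 / \<rho> < norm z \<and> norm z < \<rho>}"

text \<open>For a bounded doubly connected domain \<open>D\<close>, \<open>inside D\<close> is the bounded and \<open>outside D\<close> the
  unbounded component of the complement, so that their frontiers are the inner and the outer
  boundary component of \<open>D\<close>. The last two conjuncts say that \<open>\<phi>\<close> takes these to the inner
  and to the outer boundary circle of the annulus.\<close>

definition annular_conformal_map :: "complex set \<Rightarrow> real \<Rightarrow> (complex \<Rightarrow> complex) \<Rightarrow> bool" where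
  "annular_conformal_map D \<rho> \<phi> \<longleftrightarrow>
     \<phi> holomorphic_on D \<and> inj_on \<phi> D \<and> \<phi> ` D = annulus \<rho> \<and>
     (\<forall>p \<in> frontier (inside D). ((\<lambda>z. norm (\<phi> z)) \<longlongrightarrow> 1 / \<rho>) (at p within D)) \<and>
     (\<forall>p \<in> frontier (outside D). ((\<lambda>z. norm (\<phi> z)) \<longlongrightarrow> \<rho>) (at p within D))"

definition cut_curve :: "(complex \<Rightarrow> complex) \<Rightarrow> real \<Rightarrow> real \<Rightarrow> complex set" where
  "cut_curve \<phi> a b = \<phi> ` expE ` J_plus a b"

text \<open>\<open>\<theta>\<close> is the branch of the argument on the annulus with cut \<open>\<Gamma>\<close>. These conditions determine
  the values of \<open>\<theta>\<close> on the annulus. The last one fixes them on \<open>\<Gamma>\<close> itself, as the limit from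
  the side of \<open>cell_minus\<close>.\<close>

definition branch_arg ::
    "complex set \<Rightarrow> real \<Rightarrow> real \<Rightarrow> real \<Rightarrow> (complex \<Rightarrow> complex) \<Rightarrow> (complex \<Rightarrow> real) \<Rightarrow> bool" where
  "branch_arg \<omega> a b \<rho> \<phi> \<theta> \<longleftrightarrow>
     (let \<Gamma> = cut_curve \<phi> a b;
          S_minus = \<phi> ` expE ` cell_minus \<omega>;
          S_plus = \<phi> ` expE ` cell_plus \<omega>
      in continuous_on (annulus \<rho> - \<Gamma>) \<theta> \<and>
         (\<forall>z \<in> annulus \<rho> - \<Gamma>. is_Arg z (\<theta> z) \<and> 0 \<le> \<theta> z \<and> \<theta> z \<le> 3 * pi) \<and>
         (\<forall>p \<in> \<Gamma>. eventually (\<lambda>z. \<theta> z < pi) (at p within S_minus)) \<and>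
         (\<forall>p \<in> \<Gamma>. eventually (\<lambda>z. 2 * pi < \<theta> z) (at p within S_plus)) \<and>
         (\<forall>p \<in> \<Gamma>. (\<theta> \<longlongrightarrow> \<theta> p) (at p within S_minus)))"

definition branch_log :: "(complex \<Rightarrow> real) \<Rightarrow> complex \<Rightarrow> complex" where
  "branch_log \<theta> z = of_real (ln (norm z)) + \<i> * of_real (\<theta> z)"

definition strip_map :: "(complex \<Rightarrow> complex) \<Rightarrow> (complex \<Rightarrow> real) \<Rightarrow> complex \<Rightarrow> complex" where
  "strip_map \<phi> \<theta> z =
     1 / (\<i> * 2 * of_real pi) * branch_log \<theta> (\<phi> (expE z)) + of_int \<lfloor>Re z\<rfloor>"

definition sech :: "complex \<Rightarrow> complex" where
  "sech z = 2 / (exp z + exp (- z))"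

definition K_tilde ::
    "(complex \<Rightarrow> complex) \<Rightarrow> (complex \<Rightarrow> real) \<Rightarrow> complex \<Rightarrow> complex \<Rightarrow> complex" where
  "K_tilde \<phi> \<theta> z w =
     exp (\<i> * 2 * of_real pi * (z - strip_map \<phi> \<theta> z - cnj w + cnj (strip_map \<phi> \<theta> w)))
       * deriv \<phi> (expE z) * cnj (deriv \<phi> (expE w))"

end

theory Submission
  imports Defs
begin

text \<open>
  The map \<open>\<phi> \<circ> expE\<close> maps the periodic domain onto the annulus, and two points have the same
  image exactly if they differ by an integer; so \<open>strip_map\<close>, a logarithm of it, is a conformal map
  onto the strip
  \<open>\<bar>Im \<zeta>\<bar> < ln \<rho> / (2 \<pi>)\<close>; assumption (A) is what makes the two one-sided branches of the
  argument fit together across the cut. Composed with \<open>\<zeta> \<mapsto> tanh (c \<zeta>)\<close>, where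
  \<open>c = \<pi>\<^sup>2 / (2 ln \<rho>)\<close>, it is a conformal map onto the unit disc. Bergman kernels transform under
  a conformal map \<open>g\<close> with the factor \<open>g'(z) cnj (g'(w))\<close>, and the kernel of the disc is
  \<open>1 / (\<pi> (1 - z cnj w)\<^sup>2)\<close>, because the monomials are orthogonal and complete.
\<close>

section \<open>Conformal change of variables\<close>

unbundle no fps_syntax

text \<open>The delicate point is that \<open>strip_map\<close> is defined piecewise:
  \<open>\<theta>\<close> jumps by 2 pi across the cut, and the floor jumps by 1 across every
  translate of \<open>J_minus\<close>. After division by 2 pi these jumps cancel, so only continuity
  has to be checked by hand; holomorphy then follows because a continuous logarithm of a holomorphic
  function is holomorphic. Before this makes sense, the interior of the union of the closed cells
  has to be identified: the Lipschitz condition excludes slits and shows that neighbouring cells are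
  glued exactly along the open segments. Origin of the constants: tanh (c zeta) is conformal on a
  strip of half-width pi / (4 c), and equating this with the half-width of the image strip
  determines c. The factor c^2 / pi of the kernel of the strip then becomes pi^3 / (4 (ln
  \<rho>)^2), while \<open>K_tilde\<close> is the product of the derivative of
  \<open>strip_map\<close> at z and the conjugate of its derivative at w. Since
  \<open>bergman_kernel\<close> is a choice, exhibiting one kernel is enough only once uniqueness on
  the domain is known.\<close>

definition complex_of_vec2 :: "real^2 \<Rightarrow> complex" where
  "complex_of_vec2 x = Complex (x$1) (x$2)"

definition vec2_of_complex :: "complex \<Rightarrow> real^2" where
  "vec2_of_complex z = vector [Re z, Im z]"

lemma complex_of_vec2_inverse [simp]: "vec2_of_complex (complex_of_vec2 x) = x"
  and vec2_of_complex_inverse [simp]: "complex_of_vec2 (vec2_of_complex z) = z"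
  by (auto simp: complex_of_vec2_def vec2_of_complex_def vec_eq_iff forall_2)

lemma linear_complex_of_vec2: "linear complex_of_vec2"
  and linear_vec2_of_complex: "linear vec2_of_complex"
  by (rule linearI; simp add: complex_of_vec2_def vec2_of_complex_def vec_eq_iff forall_2 complex_eq_iff)+

lemma borel_measurable_complex_of_vec2 [measurable]: "complex_of_vec2 \<in> borel_measurable borel"
  by (intro borel_measurable_continuous_onI linear_continuous_on)
     (simp add: linear_complex_of_vec2 flip: linear_conv_bounded_linear)

lemma lborel_distr_complex_vec2:
  "distr lborel lborel complex_of_vec2 = lborel"
proof (rule lborel_eqI[symmetric])
  fix l u :: complex
  assume lu: "\<And>b. b \<in> Basis \<Longrightarrow> l \<bullet> b \<le> u \<bullet> b"
  have le: "Re l \<le> Re u" "Im l \<le> Im u"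
    using lu[of 1] lu[of \<i>] by (auto simp: Basis_complex_def)
  have eq: "complex_of_vec2 -` box l u = box (vector [Re l, Im l]) (vector [Re u, Im u])"
    by (auto simp: mem_box_cart in_box_complex_iff forall_2 complex_of_vec2_def)
  have "emeasure (distr lborel lborel complex_of_vec2) (box l u) = emeasure lborel (complex_of_vec2 -` box l u)"
    by (subst emeasure_distr) auto
  also have "\<dots> = (\<Prod>b\<in>Basis. (u - l) \<bullet> b)"
  proof -
    have B: "Basis = {axis 1 1, axis 2 1 :: real^2}"
      by (auto simp: Basis_vec_def UNIV_2)
    show ?thesis unfolding eq
      by (subst emeasure_lborel_box) (auto simp: B le inner_axis axis_eq_axis Basis_complex_def)
  qed
  finally show "emeasure (distr lborel lborel complex_of_vec2) (box l u) = (\<Prod>b\<in>Basis. (u - l) \<bullet> b)" .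
qed auto

text \<open>Writes area measure as a product of two line measures, the form in which Fubini applies;
  it serves the polar coordinates on the disc.\<close>

lemma lborel_distr_complex_prod:
  "distr (lborel \<Otimes>\<^sub>M lborel) lborel (\<lambda>(x,y). Complex x y) = lborel"
proof (rule lborel_eqI[symmetric])
  let ?V = "\<lambda>(x,y). Complex x y"
  have V[measurable]: "?V \<in> borel_measurable (lborel \<Otimes>\<^sub>M lborel)"
    unfolding lborel_prod measurable_lborel2
    unfolding case_prod_beta by (intro borel_measurable_continuous_onI continuous_intros)
  fix l u :: complex
  assume lu: "\<And>b. b \<in> Basis \<Longrightarrow> l \<bullet> b \<le> u \<bullet> b"
  have le: "Re l \<le> Re u" "Im l \<le> Im u"
    using lu[of 1] lu[of \<i>] by (auto simp: Basis_complex_def)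
  have eq: "?V -` box l u = box (Re l) (Re u) \<times> box (Im l) (Im u)"
    by (auto simp: in_box_complex_iff)
  have "emeasure (distr (lborel \<Otimes>\<^sub>M lborel) lborel ?V) (box l u) = emeasure (lborel \<Otimes>\<^sub>M lborel) (?V -` box l u)"
    by (subst emeasure_distr) (auto simp: space_pair_measure)
  also have "\<dots> = ennreal ((Re u - Re l) * (Im u - Im l))"
    unfolding eq by (subst lborel.emeasure_pair_measure_Times) (auto simp: le ennreal_mult)
  also have "\<dots> = (\<Prod>b\<in>Basis. (u - l) \<bullet> b)" by (auto simp: Basis_complex_def)
  finally show "emeasure (distr (lborel \<Otimes>\<^sub>M lborel) lborel ?V) (box l u) = (\<Prod>b\<in>Basis. (u - l) \<bullet> b)" .
qed auto

lemma lebesgue_distr_complex_vec2: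
  shows "complex_of_vec2 \<in> lebesgue \<rightarrow>\<^sub>M lebesgue"
    and "distr lebesgue lebesgue complex_of_vec2 = lebesgue"
proof -
  have eq: "distr lebesgue lborel complex_of_vec2 = lborel"
    using lborel_distr_complex_vec2 by (simp add: distr_completion)
  show "complex_of_vec2 \<in> lebesgue \<rightarrow>\<^sub>M lebesgue"
    by (simp add: completion.measurable_completion2 eq measurable_completion)
  show "distr lebesgue lebesgue complex_of_vec2 = lebesgue"
    using completion.completion_distr_eq[of complex_of_vec2 lborel lborel]
    by (simp add: eq measurable_completion)
qed

text \<open>A dictionary between the Bochner integral over sets of complex numbers, used in the
  definitions, and absolute integrability over sets in \<open>real^2\<close>, where Jacobian
  determinants are available.\<close>

lemma lebesgue_on_complex_vec2:
  fixes f :: "complex \<Rightarrow> 'b::euclidean_space"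
  assumes S: "S \<in> sets lebesgue"
  shows "complex_of_vec2 -` S \<in> sets lebesgue"
    and "integrable (lebesgue_on S) f \<longleftrightarrow> (\<lambda>x. f (complex_of_vec2 x)) absolutely_integrable_on (complex_of_vec2 -` S)"
    and "integrable (lebesgue_on S) f \<Longrightarrow> integral\<^sup>L (lebesgue_on S) f = integral (complex_of_vec2 -` S) (\<lambda>x. f (complex_of_vec2 x))"
proof -
  let ?V = complex_of_vec2
  note m = lebesgue_distr_complex_vec2(1)
  note d = lebesgue_distr_complex_vec2(2)
  show VS: "?V -` S \<in> sets lebesgue"
    using measurable_sets[OF m S] by simp
  let ?f = "\<lambda>x. indicat_real S x *\<^sub>R f x"
  \<comment> \<open>Measurability of the inverse map makes the equivalence valid for every
    \<open>f\<close>: a non-measurable function stays non-measurable after composition, and then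
    neither side is integrable. Preimages under \<open>vec2_of_complex\<close> are linear images,
    hence Lebesgue sets.\<close>
  have "vec2_of_complex \<in> lebesgue \<rightarrow>\<^sub>M lebesgue"
  proof (rule measurableI)
    fix A :: "(real^2) set" assume "A \<in> sets lebesgue"
    have "vec2_of_complex -` A = ?V ` A" by (force simp: image_iff)
    moreover have "?V ` A \<in> sets lebesgue"
    proof (rule differentiable_image_in_sets_lebesgue)
      show "?V differentiable_on A"
        by (simp add: linear_imp_differentiable_on linear_complex_of_vec2)
    qed (use \<open>A \<in> sets lebesgue\<close> in auto)
    ultimately show "vec2_of_complex -` A \<inter> space lebesgue \<in> sets lebesgue" by simp
  qed auto
  have meas: "g \<in> borel_measurable lebesgue" if "(\<lambda>x. g (?V x)) \<in> borel_measurable lebesgue" for g :: "complex \<Rightarrow> 'b"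
    using measurable_compose[OF \<open>vec2_of_complex \<in> _\<close> that] by simp
  have "integrable (lebesgue_on S) f \<longleftrightarrow> integrable lebesgue ?f"
    using S by (simp add: integrable_restrict_space)
  also have "\<dots> \<longleftrightarrow> integrable (distr lebesgue lebesgue ?V) ?f" by (simp only: d)
  also have "\<dots> \<longleftrightarrow> integrable lebesgue (\<lambda>x. ?f (?V x))"
  proof (cases "?f \<in> borel_measurable lebesgue")
    case True
    thus ?thesis by (intro integrable_distr_eq m)
  next
    case False
    hence "\<not> integrable (distr lebesgue lebesgue ?V) ?f"
      unfolding d using borel_measurable_integrable by blast
    moreover have "\<not> integrable lebesgue (\<lambda>x. ?f (?V x))"
      using False meas[of ?f] borel_measurable_integrable by blast
    ultimately show ?thesis by blast
  qed
  also have "\<dots> \<longleftrightarrow> (\<lambda>x. f (?V x)) absolutely_integrable_on (?V -` S)"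
    unfolding set_integrable_def by (simp add: indicator_def)
  finally show *: "integrable (lebesgue_on S) f \<longleftrightarrow> (\<lambda>x. f (?V x)) absolutely_integrable_on (?V -` S)" .
  assume int: "integrable (lebesgue_on S) f"
  have fi: "integrable lebesgue ?f"
    using int S by (simp add: integrable_restrict_space)
  have "integral\<^sup>L (lebesgue_on S) f = integral\<^sup>L lebesgue ?f"
    using S by (simp add: integral_restrict_space)
  also have "\<dots> = integral\<^sup>L (distr lebesgue lebesgue ?V) ?f" by (simp only: d)
  also have "\<dots> = integral\<^sup>L lebesgue (\<lambda>x. ?f (?V x))"
    using fi by (intro integral_distr m) auto
  also have "\<dots> = (LINT x:?V -` S|lebesgue. f (?V x))"
    unfolding set_lebesgue_integral_def by (simp add: indicator_def)
  also have "\<dots> = integral (?V -` S) (\<lambda>x. f (?V x))"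
    using int * by (intro set_lebesgue_integral_eq_integral(2)) auto
  finally show "integral\<^sup>L (lebesgue_on S) f = integral (?V -` S) (\<lambda>x. f (?V x))" .
qed

text \<open>In real coordinates the derivative of \<open>g\<close> at z is multiplication by
  \<open>deriv g z\<close>, a rotation with scaling, so its determinant is the square of the
  modulus.\<close>

lemma conformal_change_of_variables:
  fixes f g :: "complex \<Rightarrow> complex"
  assumes S: "open S" and g: "g holomorphic_on S" and inj: "inj_on g S"
  shows "integrable (lebesgue_on S) (\<lambda>z. of_real ((norm (deriv g z))\<^sup>2) * f (g z))
          \<longleftrightarrow> integrable (lebesgue_on (g ` S)) f" (is "?I1 \<longleftrightarrow> ?I2")
    and "(\<integral>z. of_real ((norm (deriv g z))\<^sup>2) * f (g z) \<partial>lebesgue_on S)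
          = (\<integral>z. f z \<partial>lebesgue_on (g ` S))"
proof -
  let ?V = complex_of_vec2 and ?W = vec2_of_complex
  note lW = linear_vec2_of_complex and lV = linear_complex_of_vec2
  have S': "S \<in> sets lebesgue" using S by simp
  have "open (g ` S)" using S g inj open_mapping_thm3 by blast
  hence gS': "g ` S \<in> sets lebesgue" by simp
  define G where "G = (\<lambda>x. ?W (g (?V x)))"
  define G' where "G' = (\<lambda>x h. ?W (deriv g (?V x) * ?V h))"
  have der: "(G has_derivative G' x) (at x within (?V -` S))" if "x \<in> ?V -` S" for x
  proof -
    have "(g has_field_derivative deriv g (?V x)) (at (?V x))"
      using S g that holomorphic_derivI by auto
    hence 1: "(g has_derivative (*) (deriv g (?V x))) (at (?V x))"
      by (simp add: has_field_derivative_def)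
    have "(?V has_derivative ?V) (at x)" by (simp add: lV linear_imp_has_derivative)
    from has_derivative_compose[OF this 1]
    have "((\<lambda>x. g (?V x)) has_derivative (\<lambda>h. deriv g (?V x) * ?V h)) (at x)" .
    hence "(G has_derivative G' x) (at x)" unfolding G_def G'_def
      by (intro has_derivative_compose[of "\<lambda>x. g (?V x)" _ _ _ ?W ?W]) (auto simp: lW linear_imp_has_derivative)
    thus ?thesis by (rule has_derivative_at_withinI)
  qed
  have injG: "inj_on G (?V -` S)"
    using inj unfolding inj_on_def G_def vimage_def by (metis complex_of_vec2_inverse vec2_of_complex_inverse mem_Collect_eq)
  have det: "det (matrix (G' x)) = (norm (deriv g (?V x)))\<^sup>2" for x
  proof -
    have "?V (axis 1 1) = 1" "?V (axis 2 1) = \<i>"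
      by (auto simp: complex_of_vec2_def axis_def complex_eq_iff)
    thus ?thesis
      by (simp add: det_2 matrix_def G'_def vec2_of_complex_def cmod_power2 flip: power2_eq_square)
  qed
  have img: "G ` (?V -` S) = ?V -` (g ` S)"
  proof (intro set_eqI iffI)
    fix x assume "x \<in> ?V -` (g ` S)"
    then obtain z where "z \<in> S" "?V x = g z" by auto
    hence "x = G (?W z)" "?W z \<in> ?V -` S" by (auto simp: G_def) (metis complex_of_vec2_inverse)+
    thus "x \<in> G ` (?V -` S)" by blast
  qed (auto simp: G_def)
  let ?F = "\<lambda>x. ?W (f (?V x))"
  let ?L = "\<lambda>x. \<bar>det (matrix (G' x))\<bar> *\<^sub>R ?F (G x)"
  let ?h = "\<lambda>z. of_real ((norm (deriv g z))\<^sup>2) * f (g z)"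
  have L: "?L = (\<lambda>x. ?W (?h (?V x)))"
  proof
    fix x
    have "r *\<^sub>R ?W u = ?W (of_real r * u)" for r u
      by (simp only: linear_scale[OF lW, symmetric] scaleR_conv_of_real[of r u])
    thus "?L x = ?W (?h (?V x))"
      unfolding det G_def by simp
  qed
  note main = has_absolute_integral_change_of_variables[of "?V -` S" G G' ?F,
    OF lebesgue_on_complex_vec2(1)[OF S'] der injG, unfolded img L]
  have blW: "bounded_linear ?W" using lW by (simp add: linear_conv_bounded_linear)
  have blV: "bounded_linear ?V" using lV by (simp add: linear_conv_bounded_linear)
  have ai: "(\<lambda>x. ?W (k x)) absolutely_integrable_on A \<longleftrightarrow> k absolutely_integrable_on A" for k A
  proof
    assume "(\<lambda>x. ?W (k x)) absolutely_integrable_on A"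
    from absolutely_integrable_linear[OF this blV] show "k absolutely_integrable_on A" by (simp add: o_def)
  next
    assume "k absolutely_integrable_on A"
    from absolutely_integrable_linear[OF this blW] show "(\<lambda>x. ?W (k x)) absolutely_integrable_on A" by (simp add: o_def)
  qed
  have ii: "integral A (\<lambda>x. ?W (k x)) = ?W (integral A k)" if "k absolutely_integrable_on A" for k A
    using integral_linear[OF _ blW, of k A] that by (simp add: o_def absolutely_integrable_on_def)
  show eq: "?I1 \<longleftrightarrow> ?I2"
    using main unfolding lebesgue_on_complex_vec2(2)[OF S'] lebesgue_on_complex_vec2(2)[OF gS'] ai
    by blast
  show "(\<integral>z. ?h z \<partial>lebesgue_on S) = (\<integral>z. f z \<partial>lebesgue_on (g ` S))"
  proof (cases ?I2)
    \<comment> \<open>Neither integrand is integrable, so both integrals have the default value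
      0.\<close>
    case False
    thus ?thesis using eq by (simp add: not_integrable_integral_eq)
  next
    case True
    with eq have I1: ?I1 by simp
    have A1: "(\<lambda>x. ?h (?V x)) absolutely_integrable_on (?V -` S)"
      using I1 unfolding lebesgue_on_complex_vec2(2)[OF S'] complex_of_vec2_def .
    have A2: "(\<lambda>x. f (?V x)) absolutely_integrable_on (?V -` g ` S)"
      using True unfolding lebesgue_on_complex_vec2(2)[OF gS'] complex_of_vec2_def .
    have "?W (integral (?V -` S) (\<lambda>x. ?h (?V x))) = ?W (integral (?V -` g ` S) (\<lambda>x. f (?V x)))"
      using main[of "?W (integral (?V -` g ` S) (\<lambda>x. f (?V x)))"] A2
      unfolding ai ii[OF A1] ii[OF A2] by blast
    from arg_cong[OF this, of ?V]
    have "integral (?V -` S) (\<lambda>x. ?h (?V x)) = integral (?V -` g ` S) (\<lambda>x. f (?V x))"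
      by (simp only: vec2_of_complex_inverse)
    thus ?thesis
      using lebesgue_on_complex_vec2(3)[OF S' I1] lebesgue_on_complex_vec2(3)[OF gS' True]
      by simp
  qed
qed

section \<open>The Bergman space under conformal maps\<close>

text \<open>Continuity of \<open>g\<close> would only control preimages of Borel sets. Preimages
  under \<open>g\<close> are images under the holomorphic inverse \<open>k\<close>, and a
  differentiable map sends Lebesgue sets to Lebesgue sets.\<close>

lemma measurable_compose_conformal:
  fixes g :: "complex \<Rightarrow> complex"
  assumes S: "open S" and g: "g holomorphic_on S" and inj: "inj_on g S"
    and F: "F \<in> borel_measurable (lebesgue_on (g ` S))"
  shows "(\<lambda>z. F (g z)) \<in> borel_measurable (lebesgue_on S)"
proof -
  have gS: "open (g ` S)" using S g inj open_mapping_thm3 by blast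
  obtain k where k: "k holomorphic_on (g ` S)" "\<And>z. z \<in> S \<Longrightarrow> k (g z) = z"
    using holomorphic_has_inverse[OF g S inj] by metis
  have "g \<in> lebesgue_on S \<rightarrow>\<^sub>M lebesgue_on (g ` S)"
  proof (rule measurableI)
    fix A assume "A \<in> sets (lebesgue_on (g ` S))"
    hence A: "A \<subseteq> g ` S" "A \<in> sets lebesgue" using gS by (auto simp: sets_restrict_space_iff)
    have eq: "g -` A \<inter> S = k ` A" using A(1) k(2) by (force simp: image_iff)
    have "k ` A \<in> sets lebesgue"
      using A k(1) gS holomorphic_on_imp_differentiable_on holomorphic_on_subset
      by (intro differentiable_image_in_sets_lebesgue) (auto intro: holomorphic_on_imp_differentiable_on)
    thus "g -` A \<inter> space (lebesgue_on S) \<in> sets (lebesgue_on S)"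
      using S eq by (auto simp: sets_restrict_space_iff)
  qed auto
  thus ?thesis using F by (rule measurable_compose)
qed

lemma holomorphic_on_imp_borel_measurable_lebesgue_on:
  "open S \<Longrightarrow> f holomorphic_on S \<Longrightarrow> f \<in> borel_measurable (lebesgue_on S)"
  by (intro continuous_imp_measurable_on_sets_lebesgue holomorphic_on_imp_continuous_on) auto

lemma L2_on_cong:
  assumes "\<And>z. z \<in> S \<Longrightarrow> f z = g z"
  shows "f \<in> L2_on S \<longleftrightarrow> g \<in> L2_on S"
proof -
  have "f \<in> borel_measurable (lebesgue_on S) \<longleftrightarrow> g \<in> borel_measurable (lebesgue_on S)"
    using assms by (intro measurable_cong) auto
  moreover have "integrable (lebesgue_on S) (\<lambda>z. (norm (f z))\<^sup>2) \<longleftrightarrow> integrable (lebesgue_on S) (\<lambda>z. (norm (g z))\<^sup>2)"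
    using assms by (intro Bochner_Integration.integrable_cong) auto
  ultimately show ?thesis by (simp add: L2_on_def)
qed

lemma bergman_space_cong:
  assumes "\<And>z. z \<in> S \<Longrightarrow> f z = g z"
  shows "f \<in> bergman_space S \<longleftrightarrow> g \<in> bergman_space S"
  using L2_on_cong[OF assms] holomorphic_cong[OF refl assms] by (simp add: bergman_space_def)

lemma L2_inner_cong:
  assumes "\<And>z. z \<in> S \<Longrightarrow> f z = f' z" "\<And>z. z \<in> S \<Longrightarrow> g z = g' z"
  shows "L2_inner S f g = L2_inner S f' g'"
  unfolding L2_inner_def using assms by (intro Bochner_Integration.integral_cong) auto

lemma L2_on_cmult: "f \<in> L2_on S \<Longrightarrow> (\<lambda>z. c * f z) \<in> L2_on S"
  by (auto simp: L2_on_def norm_mult power_mult_distrib)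

lemma L2_on_diff:
  assumes "f \<in> L2_on S" "g \<in> L2_on S"
  shows "(\<lambda>z. f z - g z) \<in> L2_on S"
proof -
  have "integrable (lebesgue_on S) (\<lambda>z. (norm (f z - g z))\<^sup>2)"
  proof (rule Bochner_Integration.integrable_bound)
    show "integrable (lebesgue_on S) (\<lambda>z. 2 * (norm (f z))\<^sup>2 + 2 * (norm (g z))\<^sup>2)"
      using assms by (auto simp: L2_on_def)
    have "(norm (f z - g z))\<^sup>2 \<le> 2 * (norm (f z))\<^sup>2 + 2 * (norm (g z))\<^sup>2" for z
    proof -
      have "(norm (f z - g z))\<^sup>2 \<le> (norm (f z) + norm (g z))\<^sup>2"
        by (intro power_mono norm_triangle_ineq4) auto
      also have "\<dots> \<le> 2 * (norm (f z))\<^sup>2 + 2 * (norm (g z))\<^sup>2"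
        using zero_le_power2[of "norm (f z) - norm (g z)"] by (simp add: power2_sum power2_diff)
      finally show ?thesis .
    qed
    thus "AE z in lebesgue_on S. norm ((norm (f z - g z))\<^sup>2) \<le> norm (2 * (norm (f z))\<^sup>2 + 2 * (norm (g z))\<^sup>2)"
      by auto
    have "(\<lambda>z. f z - g z) \<in> borel_measurable (lebesgue_on S)"
      using assms unfolding L2_on_def by (intro borel_measurable_diff) simp_all
    thus "(\<lambda>z. (norm (f z - g z))\<^sup>2) \<in> borel_measurable (lebesgue_on S)"
      by measurable
  qed
  thus ?thesis using assms by (auto simp: L2_on_def)
qed

lemma bergman_space_cmult: "f \<in> bergman_space S \<Longrightarrow> (\<lambda>z. c * f z) \<in> bergman_space S"
  by (auto simp: bergman_space_def intro: L2_on_cmult holomorphic_intros)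

lemma bergman_space_diff:
  "f \<in> bergman_space S \<Longrightarrow> g \<in> bergman_space S \<Longrightarrow> (\<lambda>z. f z - g z) \<in> bergman_space S"
  by (auto simp: bergman_space_def intro: L2_on_diff holomorphic_intros)

lemma L2_integrable_mult:
  assumes "f \<in> L2_on S" "g \<in> L2_on S"
  shows "integrable (lebesgue_on S) (\<lambda>z. f z * g z)"
proof (rule Bochner_Integration.integrable_bound)
  show "integrable (lebesgue_on S) (\<lambda>z. (norm (f z))\<^sup>2 + (norm (g z))\<^sup>2)"
    using assms by (auto simp: L2_on_def)
  have "norm (f z * g z) \<le> (norm (f z))\<^sup>2 + (norm (g z))\<^sup>2" for z
  proof -
    have "2 * (norm (f z) * norm (g z)) \<le> (norm (f z))\<^sup>2 + (norm (g z))\<^sup>2"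
      using zero_le_power2[of "norm (f z) - norm (g z)"] by (simp add: power2_diff)
    moreover have "0 \<le> norm (f z) * norm (g z)" by simp
    ultimately show ?thesis unfolding norm_mult by linarith
  qed
  thus "AE z in lebesgue_on S. norm (f z * g z) \<le> norm ((norm (f z))\<^sup>2 + (norm (g z))\<^sup>2)"
    by auto
  show "(\<lambda>z. f z * g z) \<in> borel_measurable (lebesgue_on S)"
    using assms unfolding L2_on_def by (intro borel_measurable_times) simp_all
qed

lemma L2_on_cnj:
  assumes "f \<in> L2_on S"
  shows "(\<lambda>z. cnj (f z)) \<in> L2_on S"
proof -
  have "cnj \<in> borel_measurable borel"
    by (intro borel_measurable_continuous_onI continuous_intros)
  with assms have "(\<lambda>z. cnj (f z)) \<in> borel_measurable (lebesgue_on S)"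
    unfolding L2_on_def by (intro measurable_compose[of f _ borel cnj]) auto
  thus ?thesis using assms by (simp add: L2_on_def)
qed

text \<open>The factor \<open>deriv g z\<close> absorbs the Jacobian, so that sending F to (F o g)
  g' preserves norms; the next lemma gives the same for inner products.\<close>

lemma L2_on_compose_conformal:
  assumes S: "open S" and g: "g holomorphic_on S" and inj: "inj_on g S"
    and F: "F \<in> L2_on (g ` S)"
  shows "(\<lambda>z. F (g z) * deriv g z) \<in> L2_on S"
proof -
  have "integrable (lebesgue_on (g ` S)) (\<lambda>u. complex_of_real ((norm (F u))\<^sup>2))"
    using F by (simp add: L2_on_def del: of_real_power)
  hence "integrable (lebesgue_on S) (\<lambda>z. of_real ((norm (deriv g z))\<^sup>2) * complex_of_real ((norm (F (g z)))\<^sup>2))"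
    using conformal_change_of_variables(1)[OF S g inj, of "\<lambda>u. complex_of_real ((norm (F u))\<^sup>2)"] by blast
  hence "integrable (lebesgue_on S) (\<lambda>z. complex_of_real ((norm (F (g z) * deriv g z))\<^sup>2))"
    by (simp add: norm_mult power_mult_distrib mult.commute del: of_real_power)
  hence "integrable (lebesgue_on S) (\<lambda>z. ((norm (F (g z) * deriv g z))\<^sup>2))"
    by (simp only: complex_of_real_integrable_eq)
  moreover have "(\<lambda>z. F (g z) * deriv g z) \<in> borel_measurable (lebesgue_on S)"
  proof (rule borel_measurable_times)
    show "(\<lambda>z. F (g z)) \<in> borel_measurable (lebesgue_on S)"
      by (rule measurable_compose_conformal[OF S g inj]) (use F in \<open>simp add: L2_on_def\<close>)
    show "deriv g \<in> borel_measurable (lebesgue_on S)"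
      by (rule holomorphic_on_imp_borel_measurable_lebesgue_on[OF S holomorphic_deriv[OF g S]])
  qed
  ultimately show ?thesis by (simp add: L2_on_def)
qed

lemma L2_inner_compose_conformal:
  assumes S: "open S" and g: "g holomorphic_on S" and inj: "inj_on g S"
  shows "L2_inner S (\<lambda>z. F (g z) * deriv g z) (\<lambda>z. G (g z) * deriv g z) = L2_inner (g ` S) F G"
proof -
  have "L2_inner S (\<lambda>z. F (g z) * deriv g z) (\<lambda>z. G (g z) * deriv g z) =
    (\<integral>z. of_real ((norm (deriv g z))\<^sup>2) * (F (g z) * cnj (G (g z))) \<partial>lebesgue_on S)"
    unfolding L2_inner_def complex_norm_square
    by (intro Bochner_Integration.integral_cong) (auto simp: algebra_simps)
  also have "\<dots> = L2_inner (g ` S) F G"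
    unfolding L2_inner_def by (rule conformal_change_of_variables(2)[OF S g inj])
  finally show ?thesis .
qed

text \<open>Sending F to (F o g) g' is unitary, with inverse of the same form built from the inverse
  map \<open>k\<close>, and it matches the two Bergman spaces. It therefore carries one orthogonal
  projection to the other; the formula is the integral kernel of the transported projection.\<close>

lemma is_bergman_kernel_conformal:
  assumes S: "open S" and g: "g holomorphic_on S" and inj: "inj_on g S"
    and K: "is_bergman_kernel (g ` S) K"
  shows "is_bergman_kernel S (\<lambda>z w. deriv g z * cnj (deriv g w) * K (g z) (g w))"
    (is "is_bergman_kernel S ?K")
proof -
  have gS: "open (g ` S)" using S g inj open_mapping_thm3 by blast
  obtain k where k: "k holomorphic_on (g ` S)" "\<And>z. z \<in> S \<Longrightarrow> deriv g z * deriv k (g z) = 1"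
      "\<And>z. z \<in> S \<Longrightarrow> k (g z) = z"
    using holomorphic_has_inverse[OF g S inj] by metis
  have kimg: "k ` g ` S = S" using k(3) by (force simp: image_iff)
  have kinj: "inj_on k (g ` S)" using k(3) by (auto simp: inj_on_def)
  have pull: "(\<lambda>z. F (g z) * deriv g z) \<in> bergman_space S" if "F \<in> bergman_space (g ` S)" for F
  proof -
    have "(F \<circ> g) holomorphic_on S"
      using that g by (intro holomorphic_on_compose) (auto simp: bergman_space_def)
    thus ?thesis using that L2_on_compose_conformal[OF S g inj] g S
      by (auto simp: bergman_space_def o_def intro!: holomorphic_intros)
  qed
  show ?thesis
    unfolding is_bergman_kernel_def
  proof (intro conjI ballI)
    fix z assume "z \<in> S"
    hence "(\<lambda>v. cnj (K (g z) v)) \<in> bergman_space (g ` S)"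
      using K by (auto simp: is_bergman_kernel_def)
    from bergman_space_cmult[OF pull[OF this], of "cnj (deriv g z)"]
    show "(\<lambda>w. cnj (?K z w)) \<in> bergman_space S"
      by (simp add: mult_ac)
  next
    fix f assume f: "f \<in> L2_on S"
    define F where "F = (\<lambda>u. f (k u) * deriv k u)"
    have F: "F \<in> L2_on (g ` S)"
      unfolding F_def using f gS k(1) kinj by (intro L2_on_compose_conformal) (auto simp: kimg)
    have f_eq: "f z = F (g z) * deriv g z" if "z \<in> S" for z
      using k(2,3)[OF that] by (simp add: F_def mult.commute)
    define G where "G = (\<lambda>u. \<integral>v. K u v * F v \<partial>lebesgue_on (g ` S))"
    have proj: "is_bergman_projection (g ` S) F G"
      using K F unfolding is_bergman_kernel_def G_def by blast
    have Kf: "(\<integral>w. ?K z w * f w \<partial>lebesgue_on S) = G (g z) * deriv g z" if "z \<in> S" for z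
    proof -
      \<comment> \<open>The factor \<open>cnj (deriv g w)\<close> of the kernel and the factor
        \<open>deriv g w\<close> of \<open>f\<close> combine to the Jacobian;
        \<open>deriv g z\<close> remains outside.\<close>
      have "(\<integral>w. ?K z w * f w \<partial>lebesgue_on S) =
        (\<integral>w. deriv g z * (of_real ((norm (deriv g w))\<^sup>2) * (K (g z) (g w) * F (g w))) \<partial>lebesgue_on S)"
        unfolding complex_norm_square
        by (intro Bochner_Integration.integral_cong) (auto simp: f_eq mult_ac)
      also have "\<dots> = deriv g z * (\<integral>w. of_real ((norm (deriv g w))\<^sup>2) * (K (g z) (g w) * F (g w)) \<partial>lebesgue_on S)"
        by (rule integral_mult_right_zero)
      also have "\<dots> = deriv g z * G (g z)"
        unfolding G_def by (subst conformal_change_of_variables(2)[OF S g inj]) (rule refl)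
      finally show ?thesis by (simp add: mult.commute)
    qed
    show "is_bergman_projection S f (\<lambda>z. \<integral>w. ?K z w * f w \<partial>lebesgue_on S)"
      unfolding is_bergman_projection_def
    proof (intro conjI ballI)
      have "(\<lambda>z. G (g z) * deriv g z) \<in> bergman_space S"
        using proj by (intro pull) (auto simp: is_bergman_projection_def)
      thus "(\<lambda>z. \<integral>w. ?K z w * f w \<partial>lebesgue_on S) \<in> bergman_space S"
        using bergman_space_cong[OF Kf] by simp
      fix h assume h: "h \<in> bergman_space S"
      define H where "H = (\<lambda>u. h (k u) * deriv k u)"
      have "H \<in> L2_on (g ` S)"
        unfolding H_def using h gS k(1) kinj by (intro L2_on_compose_conformal) (auto simp: kimg bergman_space_def)
      moreover have "H holomorphic_on (g ` S)"
      proof -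
        have "(h \<circ> k) holomorphic_on (g ` S)"
          using h k(1) by (intro holomorphic_on_compose) (auto simp: bergman_space_def kimg)
        thus ?thesis unfolding H_def using k(1) gS
          by (auto simp: o_def intro!: holomorphic_intros)
      qed
      ultimately have H: "H \<in> bergman_space (g ` S)" by (simp add: bergman_space_def)
      have h_eq: "h z = H (g z) * deriv g z" if "z \<in> S" for z
        using k(2,3)[OF that] by (simp add: H_def mult.commute)
      have "L2_inner S (\<lambda>z. f z - (\<integral>w. ?K z w * f w \<partial>lebesgue_on S)) h =
        L2_inner S (\<lambda>z. (F (g z) - G (g z)) * deriv g z) (\<lambda>z. H (g z) * deriv g z)"
      proof (rule L2_inner_cong)
        fix z assume z: "z \<in> S"
        show "f z - (\<integral>w. ?K z w * f w \<partial>lebesgue_on S) = (F (g z) - G (g z)) * deriv g z"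
          by (subst Kf[OF z], subst f_eq[OF z]) (simp add: algebra_simps)
      qed (rule h_eq)
      also have "\<dots> = L2_inner (g ` S) (\<lambda>u. F u - G u) H"
        by (rule L2_inner_compose_conformal[OF S g inj])
      also have "\<dots> = 0" using proj H by (auto simp: is_bergman_projection_def)
      finally show "L2_inner S (\<lambda>z. f z - (\<integral>w. ?K z w * f w \<partial>lebesgue_on S)) h = 0" .
    qed
  qed
qed

section \<open>Uniqueness of the Bergman kernel\<close>

lemma bergman_space_inner_self_eq_0:
  assumes S: "open S" and d: "d \<in> bergman_space S" and 0: "L2_inner S d d = 0" and z: "z \<in> S"
  shows "d z = 0"
proof (rule ccontr)
  assume nz: "d z \<noteq> 0"
  have cont: "continuous_on S d" using d by (auto simp: bergman_space_def holomorphic_on_imp_continuous_on)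
  have int: "integrable (lebesgue_on S) (\<lambda>z. (norm (d z))\<^sup>2)"
    using d by (auto simp: bergman_space_def L2_on_def)
  have "complex_of_real (\<integral>z. (norm (d z))\<^sup>2 \<partial>lebesgue_on S) = 0"
    using 0 unfolding L2_inner_def complex_norm_square[symmetric] integral_complex_of_real .
  hence "(\<integral>z. (norm (d z))\<^sup>2 \<partial>lebesgue_on S) = 0" by simp
  hence "AE z in lebesgue_on S. (norm (d z))\<^sup>2 = 0"
    using integral_nonneg_eq_0_iff_AE[OF int] by simp
  hence "AE z in lebesgue_on S. d z = 0" by simp
  hence "AE z in lebesgue. z \<in> S \<longrightarrow> d z = 0"
    using S by (subst (asm) AE_restrict_space_iff) auto
  \<comment> \<open>A function vanishing almost everywhere has a null set of non-zeros; by
    continuity this set is open, and a nonempty open set is not negligible.\<close>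
  moreover have op: "open {z \<in> S. d z \<noteq> 0}"
    using continuous_open_preimage[OF cont S, of "- {0}"]
    by (rule back_subst[where P = "\<lambda>A. open A"]) auto
  ultimately have "{z \<in> S. d z \<noteq> 0} \<in> null_sets lebesgue"
    by (subst AE_iff_null_sets) (auto elim!: eventually_mono)
  hence "negligible {z \<in> S. d z \<noteq> 0}"
    by (simp add: negligible_iff_null_sets)
  thus False using op nz z open_not_negligible by blast
qed

text \<open>The difference of \<open>h\<close> and its projection lies in the Bergman space and is
  orthogonal to that space, hence to itself.\<close>

lemma bergman_kernel_reproducing:
  assumes S: "open S" and K: "is_bergman_kernel S K" and h: "h \<in> bergman_space S" and z: "z \<in> S"
  shows "(\<integral>w. K z w * h w \<partial>lebesgue_on S) = h z"
proof -
  let ?g = "\<lambda>z. \<integral>w. K z w * h w \<partial>lebesgue_on S"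
  have p: "is_bergman_projection S h ?g"
    using K h by (auto simp: is_bergman_kernel_def bergman_space_def)
  hence d: "(\<lambda>z. h z - ?g z) \<in> bergman_space S"
    by (intro bergman_space_diff h) (auto simp: is_bergman_projection_def)
  hence "L2_inner S (\<lambda>z. h z - ?g z) (\<lambda>z. h z - ?g z) = 0"
    using p by (auto simp: is_bergman_projection_def)
  from bergman_space_inner_self_eq_0[OF S d this z] show ?thesis by simp
qed

text \<open>The conjugated kernels lie in the Bergman space, so their difference \<open>d\<close>
  may be tested against itself. Its squared norm is the difference of two reproducing integrals,
  each equal to \<open>d z\<close>. The conclusion holds at every \<open>w\<close>, not just almost
  everywhere, because \<open>d\<close> is continuous.\<close>

lemma is_bergman_kernel_unique:
  assumes S: "open S" and K: "is_bergman_kernel S K" and K': "is_bergman_kernel S K'"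
    and z: "z \<in> S" and w: "w \<in> S"
  shows "K z w = K' z w"
proof -
  define d where "d = (\<lambda>v. cnj (K z v) - cnj (K' z v))"
  have A: "(\<lambda>v. cnj (K z v)) \<in> bergman_space S" "(\<lambda>v. cnj (K' z v)) \<in> bergman_space S"
    using K K' z by (auto simp: is_bergman_kernel_def)
  hence d: "d \<in> bergman_space S" unfolding d_def by (rule bergman_space_diff)
  have int: "integrable (lebesgue_on S) (\<lambda>v. K z v * d v)" "integrable (lebesgue_on S) (\<lambda>v. K' z v * d v)"
    using L2_integrable_mult[OF L2_on_cnj, of "\<lambda>v. cnj (K z v)" S d]
      L2_integrable_mult[OF L2_on_cnj, of "\<lambda>v. cnj (K' z v)" S d] A d
    by (auto simp: bergman_space_def)
  have "L2_inner S d d = (\<integral>v. K z v * d v - K' z v * d v \<partial>lebesgue_on S)"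
    unfolding L2_inner_def by (intro Bochner_Integration.integral_cong) (auto simp: d_def algebra_simps)
  also have "\<dots> = d z - d z"
    by (simp only: Bochner_Integration.integral_diff[OF int] bergman_kernel_reproducing[OF S K d z]
        bergman_kernel_reproducing[OF S K' d z])
  finally have "d w = 0" using bergman_space_inner_self_eq_0[OF S d _ w] by simp
  thus ?thesis by (simp add: d_def)
qed

lemma bergman_kernel_eq:
  assumes S: "open S" and K: "is_bergman_kernel S K" and z: "z \<in> S" and w: "w \<in> S"
  shows "bergman_kernel S z w = K z w"
proof -
  have "is_bergman_kernel S (bergman_kernel S)"
    unfolding bergman_kernel_def using someI[of "is_bergman_kernel S", OF K] .
  from is_bergman_kernel_unique[OF S this K z w] show ?thesis .
qed

section \<open>The Bergman kernel of the unit disc\<close>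

lemma expE_eq_iff: "expE z = expE w \<longleftrightarrow> (\<exists>n::int. z = w + of_int n)"
proof -
  have "expE z = expE w \<longleftrightarrow>
      (\<exists>n::int. \<i> * 2 * of_real pi * z = \<i> * 2 * of_real pi * w + of_real (of_int (2 * n) * pi) * \<i>)"
    unfolding expE_def by (rule exp_eq)
  also have "(\<lambda>n::int. \<i> * 2 * of_real pi * z = \<i> * 2 * of_real pi * w + of_real (of_int (2 * n) * pi) * \<i>)
      = (\<lambda>n. \<i> * 2 * of_real pi * z = \<i> * 2 * of_real pi * (w + of_int n))"
    by (simp add: algebra_simps)
  finally show ?thesis by simp
qed

lemma expE_add_int: "expE (z + of_int m) = expE z" and expE_diff_int: "expE (z - of_int m) = expE z"
proof -
  show "expE (z + of_int m) = expE z" unfolding expE_eq_iff by blast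
  have "z - of_int m = z + of_int (- m)" by simp
  thus "expE (z - of_int m) = expE z" unfolding expE_eq_iff by blast
qed

lemma inj_on_expE: "inj_on expE {z. 0 < Re z \<and> Re z < 1 \<and> 0 < Im z}"
proof (rule inj_onI)
  fix z w :: complex
  assume *: "z \<in> {z. 0 < Re z \<and> Re z < 1 \<and> 0 < Im z}" "w \<in> {z. 0 < Re z \<and> Re z < 1 \<and> 0 < Im z}"
    and "expE z = expE w"
  then obtain n :: int where zw: "z = w + of_int n" by (auto simp: expE_eq_iff)
  with * have "of_int n < (1::real)" "of_int n > (-1::real)" by auto
  hence "n = 0" by linarith
  thus "z = w" using zw by simp
qed

lemma norm_expE: "norm (expE z) = exp (- 2 * pi * Im z)"
  by (simp add: expE_def)

text \<open>Polar coordinates in disguise: \<open>Re z\<close> is the angle divided by 2 pi, and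
  \<open>Im z\<close> fixes the radius exp (- 2 pi Im z). As \<open>expE\<close> is conformal and
  injective here, polar integration becomes an instance of the conformal change of
  variables.\<close>

lemma expE_upper_half_strip:
  "expE ` {z. 0 < Re z \<and> Re z < 1 \<and> 0 < Im z} = ball 0 1 - {w. Im w = 0 \<and> 0 \<le> Re w}"
proof (intro set_eqI iffI)
  fix w assume "w \<in> expE ` {z. 0 < Re z \<and> Re z < 1 \<and> 0 < Im z}"
  then obtain z where z: "0 < Re z" "Re z < 1" "0 < Im z" "w = expE z" by auto
  \<comment> \<open>A value on the slit is also attained at a purely imaginary point, and then
    \<open>Re z\<close> would have to be an integer.\<close>
  have "\<not> (Im w = 0 \<and> 0 \<le> Re w)"
  proof
    assume "Im w = 0 \<and> 0 \<le> Re w"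
    hence "w = of_real (norm w)" by (auto simp: complex_eq_iff cmod_eq_Re)
    moreover have "expE (Complex 0 (Im z)) = of_real (exp (- 2 * pi * Im z))"
      unfolding expE_def exp_of_real[symmetric] by (rule arg_cong[of _ _ exp]) (simp add: complex_eq_iff)
    ultimately have "expE z = expE (Complex 0 (Im z))"
      using z(4) norm_expE[of z] by simp
    then obtain n :: int where "z = Complex 0 (Im z) + of_int n" unfolding expE_eq_iff ..
    hence "Re z = of_int n" by (metis Re_complex_of_real add_0 complex.sel(1) of_real_of_int_eq plus_complex.simps(1))
    with z show False by simp
  qed
  moreover have "norm w < 1" using z by (simp add: norm_expE)
  ultimately show "w \<in> ball 0 1 - {w. Im w = 0 \<and> 0 \<le> Re w}" by simp
next
  fix w :: complex assume w: "w \<in> ball 0 1 - {w. Im w = 0 \<and> 0 \<le> Re w}"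
  hence w0: "w \<noteq> 0" by auto
  define t where "t = Arg2pi w / (2 * pi)"
  define z where "z = Complex t (- ln (norm w) / (2 * pi))"
  have "Arg2pi w \<noteq> 0"
    using w by (auto simp: Arg2pi_eq_0 complex_is_Real_iff)
  hence t: "0 < t" "t < 1" using Arg2pi[of w] by (auto simp: t_def field_simps)
  moreover have "0 < Im z" using w w0 by (simp add: z_def field_simps)
  moreover have "\<i> * 2 * of_real pi * z = of_real (ln (norm w)) + \<i> * of_real (Arg2pi w)"
    by (simp add: z_def t_def complex_eq_iff)
  hence "expE z = w"
    using Arg2pi[of w] w0 by (simp add: expE_def exp_add exp_of_real is_Arg_def)
  ultimately show "w \<in> expE ` {z. 0 < Re z \<and> Re z < 1 \<and> 0 < Im z}"
    by (intro image_eqI[of _ _ z]) (auto simp: z_def)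
qed

lemma expE_derivative: "(expE has_field_derivative (\<i> * 2 * of_real pi * expE z)) (at z within A)"
  unfolding expE_def by (auto intro!: derivative_eq_intros)

lemma deriv_expE: "deriv expE z = \<i> * 2 * of_real pi * expE z"
  by (rule DERIV_imp_deriv) (rule expE_derivative)

lemma holomorphic_expE: "expE holomorphic_on A"
  unfolding expE_def by (intro holomorphic_intros)

lemma negligible_horizontal_line: "negligible {w :: complex. Im w = 0}"
proof -
  have "{w :: complex. Im w = 0} = {w. \<i> \<bullet> w = 0}" by (auto simp: inner_complex_def)
  thus ?thesis using negligible_hyperplane[of \<i> 0] by simp
qed

text \<open>The slit left out by \<open>expE\<close> is a null set, and the Jacobian of
  \<open>expE\<close> supplies the density. The indicators extend the integrand from the half strip
  to the whole plane; the inner integral is the angular one.\<close>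

lemma integral_disc_polar:
  fixes f :: "complex \<Rightarrow> complex"
  assumes f: "continuous_on (ball 0 1) f" and int: "integrable (lebesgue_on (ball 0 1)) f"
  defines "F \<equiv> (\<lambda>x y. indicator {0<..<1} x * (indicator {0<..} y *
             (of_real (4 * pi\<^sup>2 * exp (- 4 * pi * y)) * f (expE (Complex x y)))))"
  shows "integrable lborel (\<lambda>y. \<integral>x. F x y \<partial>lborel)"
    and "(\<integral>z. f z \<partial>lebesgue_on (ball 0 1)) = (\<integral>y. \<integral>x. F x y \<partial>lborel \<partial>lborel)"
proof -
  define S where "S = {z. 0 < Re z \<and> Re z < 1 \<and> 0 < Im z}"
  have S: "open S"
    unfolding S_def by (intro open_Collect_conj open_halfspace_Re_gt open_halfspace_Re_lt open_halfspace_Im_gt)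
  have img: "expE ` S = ball 0 1 - {w. Im w = 0 \<and> 0 \<le> Re w}"
    unfolding S_def by (rule expE_upper_half_strip)
  have opE: "open (expE ` S)"
    using S holomorphic_expE inj_on_expE[folded S_def] open_mapping_thm3 by blast
  have sub: "expE ` S \<subseteq> ball 0 1" using img by auto
  have int1: "integrable (lebesgue_on (expE ` S)) f"
  proof (rule absolutely_integrable_imp_integrable)
    have "f absolutely_integrable_on ball 0 1"
      using int by (simp add: integrable_restrict_space set_integrable_def)
    thus "f absolutely_integrable_on expE ` S"
      by (rule set_integrable_subset) (use sub opE in auto)
  qed (use opE in auto)
  have "(\<integral>z. f z \<partial>lebesgue_on (ball 0 1)) = integral (ball 0 1) f"
    by (rule lebesgue_integral_eq_integral[OF int]) simp
  also have "\<dots> = integral (expE ` S) f"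
  proof (rule integral_spike_set)
    have "ball 0 1 - expE ` S \<subseteq> {w. Im w = 0}" using img by auto
    thus "negligible {x \<in> ball 0 1 - expE ` S. f x \<noteq> 0}"
      by (intro negligible_subset[OF negligible_horizontal_line]) auto
    have "expE ` S - ball 0 1 = {}" using sub by auto
    thus "negligible {x \<in> expE ` S - ball 0 1. f x \<noteq> 0}" by (simp only:) simp
  qed
  also have "\<dots> = (\<integral>z. f z \<partial>lebesgue_on (expE ` S))"
    using opE by (intro lebesgue_integral_eq_integral[OF int1, symmetric]) simp
  also have "\<dots> = (\<integral>z. of_real ((norm (deriv expE z))\<^sup>2) * f (expE z) \<partial>lebesgue_on S)"
    by (rule conformal_change_of_variables(2)[OF S holomorphic_expE inj_on_expE[folded S_def], symmetric])
  finally have eq1: "(\<integral>z. f z \<partial>lebesgue_on (ball 0 1)) = \<dots>" .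
  define G where "G = (\<lambda>z. of_real ((norm (deriv expE z))\<^sup>2) * f (expE z))"
  have intG: "integrable (lebesgue_on S) G"
    using int1 conformal_change_of_variables(1)[OF S holomorphic_expE inj_on_expE[folded S_def], of f]
    unfolding G_def by blast
  define H where "H = (\<lambda>z. indicat_real S z *\<^sub>R G z)"
  have contG: "continuous_on S G"
    unfolding G_def deriv_expE
    using sub by (intro continuous_intros continuous_on_compose2[OF f] holomorphic_on_imp_continuous_on holomorphic_expE) auto
  \<comment> \<open>Fubini is applied to the uncompleted product measure, so the integrand must be
    Borel measurable; continuity of \<open>f\<close> gives this.\<close>
  have Hm: "H \<in> borel_measurable borel"
    unfolding H_def using S contG by (intro borel_measurable_continuous_on_indicator) auto
  have H1: "integrable lebesgue H"
    using intG S unfolding H_def by (simp add: integrable_restrict_space)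
  have H2: "integrable lborel H"
    using H1 Hm by (simp add: integrable_completion)
  have "integral\<^sup>L (lebesgue_on S) G = integral\<^sup>L lebesgue H"
    unfolding H_def using S by (simp add: integral_restrict_space)
  also have "\<dots> = integral\<^sup>L lborel H"
    using Hm by (simp add: integral_completion)
  finally have eq2: "integral\<^sup>L (lebesgue_on S) G = integral\<^sup>L lborel H" .
  have Cm: "(\<lambda>(x,y). Complex x y) \<in> (lborel \<Otimes>\<^sub>M lborel) \<rightarrow>\<^sub>M lborel"
    unfolding lborel_prod measurable_lborel2 case_prod_beta
    by (simp, intro borel_measurable_continuous_onI continuous_intros)
  have HF: "H (Complex x y) = F x y" for x y
  proof -
    have "exp (- (2 * pi * y)) * exp (- (2 * pi * y)) = exp (- 4 * pi * y)"
      by (subst exp_add[symmetric]) simp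
    hence "(norm (deriv expE (Complex x y)))\<^sup>2 = 4 * pi\<^sup>2 * exp (- 4 * pi * y)"
      by (simp add: deriv_expE norm_mult norm_expE power_mult_distrib power2_eq_square)
    thus ?thesis
      unfolding H_def G_def F_def S_def by (auto simp: indicator_def simp del: of_real_mult of_real_power)
  qed
  have case_eq: "(\<lambda>p. H (case p of (x,y) \<Rightarrow> Complex x y)) = (\<lambda>(x,y). F x y)"
    by (auto simp: HF)
  have I: "integrable (lborel \<Otimes>\<^sub>M lborel) (\<lambda>(x,y). F x y)"
    using H2 Hm integrable_distr_eq[OF Cm, of H] unfolding lborel_distr_complex_prod case_eq by simp
  have "integral\<^sup>L lborel H = integral\<^sup>L (lborel \<Otimes>\<^sub>M lborel) (\<lambda>(x,y). F x y)"
    using Hm integral_distr[OF Cm, of H] unfolding lborel_distr_complex_prod case_eq by simp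
  also have "\<dots> = (\<integral>y. \<integral>x. F x y \<partial>lborel \<partial>lborel)"
    by (rule lborel_pair.integral_snd[OF I, symmetric])
  finally show "(\<integral>z. f z \<partial>lebesgue_on (ball 0 1)) = (\<integral>y. \<integral>x. F x y \<partial>lborel \<partial>lborel)"
    using eq1 eq2 unfolding G_def by simp
  show "integrable lborel (\<lambda>y. \<integral>x. F x y \<partial>lborel)"
    by (rule lborel_pair.integrable_snd[OF I])
qed

text \<open>On the circle of radius r = exp (- 2 pi y) one has cnj u = r^2 / u, which turns the
  integrand into r^(2n) times that of Cauchy's formula for the n-th Taylor coefficient.\<close>

lemma disc_circle_integral:
  assumes h: "h holomorphic_on ball 0 1" and y: "0 < y"
  shows "(\<integral>x. indicator {0<..<1} x * (h (expE (Complex x y)) * cnj (expE (Complex x y)) ^ n) \<partial>lborel)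
           = (deriv ^^ n) h 0 / fact n * of_real (exp (- 4 * pi * real n * y))"
proof -
  define r where "r = exp (- 2 * pi * y)"
  have r: "0 < r" "r < 1" using y by (auto simp: r_def)
  have E: "expE (Complex x y) = of_real r * exp (2 * of_real pi * \<i> * of_real x)" for x
  proof -
    have "\<i> * 2 * of_real pi * Complex x y = of_real (- 2 * pi * y) + 2 * of_real pi * \<i> * of_real x"
      by (simp add: complex_eq_iff)
    thus ?thesis unfolding expE_def r_def by (simp only: exp_add exp_of_real)
  qed
  define u where "u = (\<lambda>x. expE (Complex x y))"
  have u0: "u x \<noteq> 0" for x by (simp add: u_def expE_def)
  have unorm: "norm (u x) = r" for x by (simp add: u_def norm_expE r_def)
  have cu: "cnj (u x) = of_real (r\<^sup>2) / u x" for x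
    using complex_norm_square[of "u x"] u0[of x] by (simp add: unorm field_simps)
  let ?k = "\<lambda>x. h (u x) * cnj (u x) ^ n"
  have contu: "continuous_on A u" for A unfolding u_def E by (intro continuous_intros)
  have hc: "continuous_on (ball 0 1) h" using h by (rule holomorphic_on_imp_continuous_on)
  have contk: "continuous_on {0..1} ?k"
    by (intro continuous_intros continuous_on_compose2[OF hc] contu) (use unorm r in auto)
  have "((\<lambda>u. h u / (u - 0) ^ Suc n) has_contour_integral ((of_real (2 * pi) * \<i>) / fact n * (deriv ^^ n) h 0)) (circlepath 0 r)"
    by (rule Cauchy_has_contour_integral_higher_derivative_circlepath)
       (use r in \<open>auto intro!: holomorphic_on_subset[OF h] continuous_on_subset[OF hc]\<close>)
  hence "((\<lambda>x. h (u x) / u x ^ Suc n * (2 * of_real pi * \<i> * u x)) has_integral ((of_real (2 * pi) * \<i>) / fact n * (deriv ^^ n) h 0)) {0..1}"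
    unfolding has_contour_integral_def
  proof (rule has_integral_eq[rotated])
    fix x :: real assume "x \<in> {0..1}"
    hence "vector_derivative (circlepath 0 r) (at x within {0..1}) = 2 * of_real pi * \<i> * r * exp (2 * of_real pi * \<i> * x)"
      by (simp add: vector_derivative_circlepath01)
    moreover have "circlepath 0 r x = u x" by (simp add: circlepath u_def E)
    ultimately show "h (circlepath 0 r x) / (circlepath 0 r x - 0) ^ Suc n * vector_derivative (circlepath 0 r) (at x within {0..1})
      = h (u x) / u x ^ Suc n * (2 * of_real pi * \<i> * u x)"
      by (simp add: u_def E mult_ac)
  qed
  hence "((\<lambda>x. (of_real (r\<^sup>2) ^ n / (2 * of_real pi * \<i>)) * (h (u x) / u x ^ Suc n * (2 * of_real pi * \<i> * u x)))
     has_integral ((of_real (r\<^sup>2) ^ n / (2 * of_real pi * \<i>)) * ((of_real (2 * pi) * \<i>) / fact n * (deriv ^^ n) h 0))) {0..1}"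
    by (rule has_integral_mult_right)
  hence hi: "(?k has_integral (of_real (r\<^sup>2) ^ n * ((deriv ^^ n) h 0 / fact n))) {0..1}"
    using u0 by (simp add: cu power_divide field_simps)
  have "(\<integral>x. indicator {0<..<1} x * ?k x \<partial>lborel) = (LINT x:{0<..<1}|lborel. ?k x)"
    unfolding set_lebesgue_integral_def by (intro Bochner_Integration.integral_cong) (auto simp: indicator_def)
  also have "\<dots> = integral {0<..<1} ?k"
  proof (rule set_borel_integral_eq_integral(2))
    have "set_integrable lborel {0..1} ?k"
      using borel_integrable_compact[OF _ contk] unfolding set_integrable_def by simp
    thus "set_integrable lborel {0<..<1} ?k"
      by (rule set_integrable_subset) auto
  qed
  also have "\<dots> = integral {0..1} ?k"
    using integral_open_interval_real[of 0 1 ?k] by simp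
  also have "\<dots> = of_real (r\<^sup>2) ^ n * ((deriv ^^ n) h 0 / fact n)"
    using hi by (rule integral_unique)
  also have "complex_of_real (r\<^sup>2) ^ n = of_real (exp (- 4 * pi * real n * y))"
  proof -
    have "(r\<^sup>2) ^ n = exp (- 4 * pi * real n * y)"
      unfolding r_def exp_of_nat_mult[symmetric] power_mult[symmetric]
      by (simp add: algebra_simps flip: exp_of_nat_mult)
    thus ?thesis by (metis of_real_power)
  qed
  finally show ?thesis unfolding u_def by (simp add: mult_ac)
qed

text \<open>The angular integral already isolates one Taylor coefficient, so the series of
  \<open>h\<close> is never integrated term by term; only an exponential remains to be integrated
  over the radial variable.\<close>

lemma disc_integral_monomial:
  assumes h: "h holomorphic_on ball 0 1" and int: "integrable (lebesgue_on (ball 0 1)) (\<lambda>w. h w * cnj w ^ n)"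
  shows "(\<integral>w. h w * cnj w ^ n \<partial>lebesgue_on (ball 0 1)) = of_real (pi / (real n + 1)) * ((deriv ^^ n) h 0 / fact n)"
proof -
  let ?f = "\<lambda>w. h w * cnj w ^ n"
  let ?F = "\<lambda>x y. indicator {0<..<1} x * (indicator {0<..} y *
             (of_real (4 * pi\<^sup>2 * exp (- 4 * pi * y)) * ?f (expE (Complex x y))))"
  let ?a = "(deriv ^^ n) h 0 / fact n"
  have cont: "continuous_on (ball 0 1) ?f"
    using h by (intro continuous_intros holomorphic_on_imp_continuous_on)
  \<comment> \<open>Collects 4 pi from the Jacobian and 4 pi n from the factor r^(2n).\<close>
  define k where "k = 4 * pi * (real n + 1)"
  have k: "0 < k" unfolding k_def by (intro mult_pos_pos) auto
  have inner: "(\<integral>x. ?F x y \<partial>lborel) = (if 0 < y then of_real (4 * pi\<^sup>2 * exp (- k * y)) * ?a else 0)" for y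
  proof (cases "0 < y")
    case True
    have "(\<integral>x. ?F x y \<partial>lborel) = (\<integral>x. of_real (4 * pi\<^sup>2 * exp (- 4 * pi * y)) *
        (indicator {0<..<1} x * ?f (expE (Complex x y))) \<partial>lborel)"
      using True by (intro Bochner_Integration.integral_cong) (auto simp: mult_ac)
    also have "\<dots> = of_real (4 * pi\<^sup>2 * exp (- 4 * pi * y)) * (?a * of_real (exp (- 4 * pi * real n * y)))"
      by (simp only: integral_mult_right_zero disc_circle_integral[OF h True])
    also have "\<dots> = of_real (4 * pi\<^sup>2 * (exp (- 4 * pi * y) * exp (- 4 * pi * real n * y))) * ?a"
      by simp
    also have "exp (- 4 * pi * y) * exp (- 4 * pi * real n * y) = exp (- k * y)"
      unfolding k_def by (subst exp_add[symmetric]) (simp add: algebra_simps)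
    finally show ?thesis using True by simp
  qed simp
  have "(\<integral>w. ?f w \<partial>lebesgue_on (ball 0 1)) = (\<integral>y. \<integral>x. ?F x y \<partial>lborel \<partial>lborel)"
    by (rule integral_disc_polar(2)[OF cont int])
  also have "\<dots> = integral UNIV (\<lambda>y. \<integral>x. ?F x y \<partial>lborel)"
    by (rule integral_lborel[OF integral_disc_polar(1)[OF cont int], symmetric])
  also have "\<dots> = integral UNIV (\<lambda>y. if y \<in> {0<..} then of_real (4 * pi\<^sup>2 * exp (- k * y)) * ?a else 0)"
    unfolding inner by simp
  also have "\<dots> = integral {0<..} (\<lambda>y. of_real (4 * pi\<^sup>2 * exp (- k * y)) * ?a)"
    by (rule integral_restrict_UNIV)
  also have "\<dots> = integral {0..} (\<lambda>y. of_real (4 * pi\<^sup>2 * exp (- k * y)) * ?a)"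
    by (rule integral_spike_set; rule negligible_subset[of "{0}"]) auto
  also have "\<dots> = of_real (pi / (real n + 1)) * ?a"
  proof (rule integral_unique)
    have "((\<lambda>y. exp (- k * y)) has_integral (exp (- k * 0) / k)) {0..}"
      by (rule has_integral_exp_minus_to_infinity[OF k])
    hence "((\<lambda>y. 4 * pi\<^sup>2 * exp (- k * y)) has_integral (4 * pi\<^sup>2 * (exp (- k * 0) / k))) {0..}"
      by (rule has_integral_mult_right)
    hence "((\<lambda>y. complex_of_real (4 * pi\<^sup>2 * exp (- k * y))) has_integral (of_real (4 * pi\<^sup>2 * (exp (- k * 0) / k)))) {0..}"
      by (rule has_integral_of_real)
    hence "((\<lambda>y. complex_of_real (4 * pi\<^sup>2 * exp (- k * y)) * ?a) has_integral (of_real (4 * pi\<^sup>2 * (exp (- k * 0) / k)) * ?a)) {0..}"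
      by (rule has_integral_mult_left)
    moreover have "4 * pi\<^sup>2 * (exp (- k * 0) / k) = pi / (real n + 1)"
    proof -
      define m where "m = real n + 1"
      have "0 < m" by (simp add: m_def)
      thus ?thesis
        unfolding k_def m_def[symmetric] by (simp add: power2_eq_square field_simps)
    qed
    ultimately show "((\<lambda>y. complex_of_real (4 * pi\<^sup>2 * exp (- k * y)) * ?a) has_integral (of_real (pi / (real n + 1)) * ?a)) {0..}"
      by (simp only:)
  qed
  finally show ?thesis .
qed

section \<open>Square-integrable functions and their limits\<close>

lemma integrable_disc_bounded:
  fixes f :: "complex \<Rightarrow> 'a::{banach,second_countable_topology}"
  assumes "f \<in> borel_measurable (lebesgue_on (ball 0 1))" "\<And>w. w \<in> ball 0 1 \<Longrightarrow> norm (f w) \<le> B"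
  shows "integrable (lebesgue_on (ball 0 1)) f"
proof -
  interpret finite_measure "lebesgue_on (ball 0 1 :: complex set)"
    by (rule finite_measure_lebesgue_on) simp
  show ?thesis
    using assms by (intro integrable_const_bound[of _ B]) (auto intro!: AE_I2)
qed

lemma L2_on_disc_bounded:
  assumes m: "f \<in> borel_measurable (lebesgue_on (ball 0 1))" and b: "\<And>w. w \<in> ball 0 1 \<Longrightarrow> norm (f w) \<le> B"
  shows "f \<in> L2_on (ball 0 1)"
proof -
  have "integrable (lebesgue_on (ball 0 1)) (\<lambda>w. (norm (f w))\<^sup>2)"
  proof (rule integrable_disc_bounded)
    show "(\<lambda>w. (norm (f w))\<^sup>2) \<in> borel_measurable (lebesgue_on (ball 0 1))"
      using m by measurable
    show "norm ((norm (f w))\<^sup>2) \<le> B\<^sup>2" if "w \<in> ball 0 1" for w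
      using b[OF that] by (simp add: power_mono)
  qed
  thus ?thesis using m by (simp add: L2_on_def)
qed

lemma L2_on_disc_integrable:
  assumes "f \<in> L2_on (ball 0 1)"
  shows "integrable (lebesgue_on (ball 0 1)) f"
proof -
  have "(\<lambda>w. 1) \<in> L2_on (ball 0 1)"
    by (rule L2_on_disc_bounded[of _ 1]) auto
  from L2_integrable_mult[OF assms this] show ?thesis by simp
qed

lemma L2_on_sum:
  "finite I \<Longrightarrow> (\<And>i. i \<in> I \<Longrightarrow> f i \<in> L2_on S) \<Longrightarrow> (\<lambda>z. \<Sum>i\<in>I. f i z) \<in> L2_on S"
proof (induction I rule: finite_induct)
  case empty
  show ?case by (simp add: L2_on_def)
next
  case (insert i I)
  have "(\<lambda>z. f i z - (-1) * (\<Sum>i\<in>I. f i z)) \<in> L2_on S"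
    using insert by (intro L2_on_diff L2_on_cmult) auto
  thus ?case using insert by simp
qed

lemma L2_inner_diff_left:
  assumes "f \<in> L2_on S" "g \<in> L2_on S" "h \<in> L2_on S"
  shows "L2_inner S (\<lambda>z. f z - g z) h = L2_inner S f h - L2_inner S g h"
  unfolding L2_inner_def left_diff_distrib
  using assms by (intro Bochner_Integration.integral_diff L2_integrable_mult L2_on_cnj)

lemma L2_inner_diff_right:
  assumes "f \<in> L2_on S" "g \<in> L2_on S" "h \<in> L2_on S"
  shows "L2_inner S h (\<lambda>z. f z - g z) = L2_inner S h f - L2_inner S h g"
  unfolding L2_inner_def complex_cnj_diff right_diff_distrib
  using assms by (intro Bochner_Integration.integral_diff L2_integrable_mult L2_on_cnj)

lemma L2_inner_sum_right:
  assumes "finite I" "\<And>i. i \<in> I \<Longrightarrow> f i \<in> L2_on S" "h \<in> L2_on S"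
  shows "L2_inner S h (\<lambda>z. \<Sum>i\<in>I. c i * f i z) = (\<Sum>i\<in>I. cnj (c i) * L2_inner S h (f i))"
proof -
  have "L2_inner S h (\<lambda>z. \<Sum>i\<in>I. c i * f i z) = (\<integral>z. (\<Sum>i\<in>I. cnj (c i) * (h z * cnj (f i z))) \<partial>lebesgue_on S)"
    unfolding L2_inner_def by (intro Bochner_Integration.integral_cong) (auto simp: sum_distrib_left mult_ac)
  also have "\<dots> = (\<Sum>i\<in>I. \<integral>z. cnj (c i) * (h z * cnj (f i z)) \<partial>lebesgue_on S)"
    using assms by (intro Bochner_Integration.integral_sum integrable_mult_right L2_integrable_mult L2_on_cnj) auto
  also have "\<dots> = (\<Sum>i\<in>I. cnj (c i) * L2_inner S h (f i))"
    unfolding L2_inner_def by simp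
  finally show ?thesis .
qed

lemma L2_inner_commute: "L2_inner S g f = cnj (L2_inner S f g)"
  unfolding L2_inner_def Bochner_Integration.integral_cnj[symmetric] by (simp add: mult.commute)

lemma L2_inner_self: "L2_inner S f f = of_real (\<integral>z. (norm (f z))\<^sup>2 \<partial>lebesgue_on S)"
  unfolding L2_inner_def complex_norm_square[symmetric] by (rule integral_complex_of_real)

text \<open>The weighted inequality |u v| <= k |u|^2 + |v|^2 / k takes the place of Cauchy-Schwarz:
  a small k controls the first term, and then a large n controls the second.\<close>

lemma L2_inner_tendsto_0:
  assumes u: "u \<in> L2_on S" and v: "\<And>n. v n \<in> L2_on S"
    and lim: "(\<lambda>n. \<integral>z. (norm (v n z))\<^sup>2 \<partial>lebesgue_on S) \<longlonglongrightarrow> 0"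
  shows "(\<lambda>n. L2_inner S u (v n)) \<longlonglongrightarrow> 0"
proof (rule LIMSEQ_I)
  fix e :: real assume e: "0 < e"
  define U where "U = (\<integral>z. (norm (u z))\<^sup>2 \<partial>lebesgue_on S)"
  have U: "0 \<le> U" unfolding U_def by simp
  \<comment> \<open>Chosen so that k U < e; the summand 1 keeps the denominator positive when U =
    0.\<close>
  define k where "k = e / (2 * (U + 1))"
  have k: "0 < k" using e U by (simp add: k_def)
  have "e * U < e * (2 * (U + 1))" using e U by (intro mult_strict_left_mono) auto
  hence kU: "k * U < e" using U by (simp add: k_def pos_divide_less_eq)
  have "0 < (e - k * U) * k" using k kU by simp
  with lim obtain N where N: "\<And>n. n \<ge> N \<Longrightarrow> \<bar>\<integral>z. (norm (v n z))\<^sup>2 \<partial>lebesgue_on S\<bar> < (e - k * U) * k"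
    unfolding LIMSEQ_iff by (metis diff_zero real_norm_def)
  have "norm (L2_inner S u (v n) - 0) < e" if "n \<ge> N" for n
  proof -
    let ?V = "\<integral>z. (norm (v n z))\<^sup>2 \<partial>lebesgue_on S"
    have "norm (L2_inner S u (v n)) \<le> (\<integral>z. norm (u z * cnj (v n z)) \<partial>lebesgue_on S)"
      unfolding L2_inner_def by (rule integral_norm_bound)
    also have "\<dots> \<le> (\<integral>z. k * (norm (u z))\<^sup>2 + (norm (v n z))\<^sup>2 / k \<partial>lebesgue_on S)"
    proof (rule integral_mono)
      show "integrable (lebesgue_on S) (\<lambda>z. norm (u z * cnj (v n z)))"
        using u v by (intro integrable_norm L2_integrable_mult L2_on_cnj)
      show "integrable (lebesgue_on S) (\<lambda>z. k * (norm (u z))\<^sup>2 + (norm (v n z))\<^sup>2 / k)"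
        using u v[of n] by (auto simp: L2_on_def)
      fix z
      let ?a = "norm (u z)" and ?b = "norm (v n z)"
      have "0 \<le> (k * ?a - ?b)\<^sup>2" by simp
      hence "2 * k * (?a * ?b) \<le> k\<^sup>2 * ?a\<^sup>2 + ?b\<^sup>2" by (simp add: power2_eq_square algebra_simps)
      moreover have "k * (?a * ?b) \<ge> 0" using k by simp
      ultimately have "k * (?a * ?b) \<le> k\<^sup>2 * ?a\<^sup>2 + ?b\<^sup>2" by linarith
      hence "?a * ?b \<le> (k\<^sup>2 * ?a\<^sup>2 + ?b\<^sup>2) / k" using k by (simp add: pos_le_divide_eq mult.commute)
      also have "\<dots> = k * ?a\<^sup>2 + ?b\<^sup>2 / k" using k by (simp add: add_divide_distrib power2_eq_square)
      finally show "norm (u z * cnj (v n z)) \<le> k * ?a\<^sup>2 + ?b\<^sup>2 / k" by (simp add: norm_mult)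
    qed
    also have "\<dots> = k * U + ?V / k"
      using u v[of n] unfolding U_def by (subst Bochner_Integration.integral_add) (auto simp: L2_on_def)
    also have "\<dots> < e" using N[OF that] k by (simp add: field_simps)
    finally show ?thesis by simp
  qed
  thus "\<exists>N. \<forall>n\<ge>N. norm (L2_inner S u (v n) - 0) < e" by blast
qed

text \<open>Fatou's lemma turns pointwise convergence with bounded norms into membership in L2
  together with the same bound on the norm of the limit.\<close>

lemma L2_fatou:
  fixes f :: "complex \<Rightarrow> complex"
  assumes f: "f \<in> borel_measurable (lebesgue_on S)" and p: "\<And>n::nat. p n \<in> L2_on S"
    and lim: "\<And>z. z \<in> S \<Longrightarrow> (\<lambda>n. p n z) \<longlonglongrightarrow> f z"
    and B: "\<And>n. (\<integral>z. (norm (p n z))\<^sup>2 \<partial>lebesgue_on S) \<le> B"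
  shows "f \<in> L2_on S" and "(\<integral>z. (norm (f z))\<^sup>2 \<partial>lebesgue_on S) \<le> B"
proof -
  let ?M = "lebesgue_on S"
  have B0: "0 \<le> B" using B[of 0] by (rule order_trans[rotated]) simp
  have pm: "p n \<in> borel_measurable ?M" and pi: "integrable ?M (\<lambda>z. (norm (p n z))\<^sup>2)" for n
    using p[of n] by (auto simp: L2_on_def)
  have fm: "(\<lambda>z. (norm (f z))\<^sup>2) \<in> borel_measurable ?M" using f by measurable
  have "(\<integral>\<^sup>+z. ennreal ((norm (f z))\<^sup>2) \<partial>?M) = (\<integral>\<^sup>+z. liminf (\<lambda>n. ennreal ((norm (p n z))\<^sup>2)) \<partial>?M)"
  proof (rule nn_integral_cong)
    fix z assume "z \<in> space ?M"
    hence "(\<lambda>n. ennreal ((norm (p n z))\<^sup>2)) \<longlonglongrightarrow> ennreal ((norm (f z))\<^sup>2)"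
      using lim[of z] by (intro tendsto_intros) auto
    thus "ennreal ((norm (f z))\<^sup>2) = liminf (\<lambda>n. ennreal ((norm (p n z))\<^sup>2))"
      by (intro lim_imp_Liminf[symmetric]) auto
  qed
  also have "\<dots> \<le> liminf (\<lambda>n. \<integral>\<^sup>+z. ennreal ((norm (p n z))\<^sup>2) \<partial>?M)"
    using pm by (intro nn_integral_liminf) measurable
  also have "\<dots> \<le> liminf (\<lambda>n. ennreal B)"
  proof (intro Liminf_mono always_eventually allI)
    fix n
    show "(\<integral>\<^sup>+z. ennreal ((norm (p n z))\<^sup>2) \<partial>?M) \<le> ennreal B"
      using B[of n] by (subst nn_integral_eq_integral[OF pi]) (auto intro: ennreal_leI)
  qed
  also have "\<dots> = ennreal B" by (simp add: Liminf_const)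
  finally have le: "(\<integral>\<^sup>+z. ennreal ((norm (f z))\<^sup>2) \<partial>?M) \<le> ennreal B" .
  have int: "integrable ?M (\<lambda>z. (norm (f z))\<^sup>2)"
    by (rule integrableI_bounded) (use fm le in \<open>auto simp: intro: le_less_trans\<close>)
  thus "f \<in> L2_on S" using f by (simp add: L2_on_def)
  show "(\<integral>z. (norm (f z))\<^sup>2 \<partial>?M) \<le> B"
    using le nn_integral_eq_integral[OF int] B0 by simp
qed

section \<open>Monomials as an orthogonal system on the disc\<close>

lemma monomial_L2_on_disc: "(\<lambda>w. w ^ n) \<in> L2_on (ball 0 1)"
proof (rule L2_on_disc_bounded)
  show "(\<lambda>w::complex. w ^ n) \<in> borel_measurable (lebesgue_on (ball 0 1))"
    by (intro holomorphic_on_imp_borel_measurable_lebesgue_on holomorphic_intros) auto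
  show "norm (w ^ n) \<le> 1" if "w \<in> ball 0 1" for w :: complex
    using that by (simp add: norm_power power_le_one)
qed

lemma L2_inner_disc_holomorphic_monomial:
  assumes "h \<in> bergman_space (ball 0 1)"
  shows "L2_inner (ball 0 1) h (\<lambda>w. w ^ n) = of_real (pi / (real n + 1)) * ((deriv ^^ n) h 0 / fact n)"
  using disc_integral_monomial[of h n] L2_integrable_mult[OF _ L2_on_cnj[OF monomial_L2_on_disc], of h n] assms
  by (simp add: L2_inner_def bergman_space_def)

lemma L2_inner_disc_monomials:
  "L2_inner (ball 0 1) (\<lambda>w. w ^ m) (\<lambda>w. w ^ n) = (if m = n then of_real (pi / (real n + 1)) else 0)"
proof -
  have "(\<lambda>w. w ^ m) \<in> bergman_space (ball 0 1)"
    using monomial_L2_on_disc by (auto simp: bergman_space_def intro: holomorphic_intros)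
  moreover have "(deriv ^^ n) (\<lambda>w::complex. w ^ m) 0 / fact n = (if m = n then 1 else 0)"
    using higher_deriv_power[of n 0 m 0]
    by (auto simp: pochhammer_fact[symmetric] pochhammer_0_left)
  ultimately show ?thesis by (simp add: L2_inner_disc_holomorphic_monomial del: of_real_divide)
qed

text \<open>The Fourier coefficient of \<open>f\<close> along the monomial of degree n. The
  prefactor is the inverse of the squared norm pi / (n + 1), so for a Bergman function the value is
  its Taylor coefficient.\<close>

definition disc_coeff :: "(complex \<Rightarrow> complex) \<Rightarrow> nat \<Rightarrow> complex" where
  "disc_coeff f n = of_real ((real n + 1) / pi) * L2_inner (ball 0 1) f (\<lambda>w. w ^ n)"

lemma disc_coeff_inverse: "L2_inner (ball 0 1) f (\<lambda>w. w ^ n) = of_real (pi / (real n + 1)) * disc_coeff f n"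
proof -
  have "real n + 1 \<noteq> 0" by linarith
  hence "(pi / (real n + 1)) * ((real n + 1) / pi) = 1" by simp
  hence "complex_of_real (pi / (real n + 1)) * of_real ((real n + 1) / pi) = 1"
    by (metis of_real_1 of_real_mult)
  thus ?thesis unfolding disc_coeff_def mult.assoc[symmetric] by simp
qed

lemma disc_coeff_holomorphic:
  assumes "h \<in> bergman_space (ball 0 1)"
  shows "disc_coeff h n = (deriv ^^ n) h 0 / fact n"
proof -
  have "real n + 1 \<noteq> 0" by linarith
  hence "complex_of_real (pi / (real n + 1)) \<noteq> 0" by (simp del: of_real_divide)
  thus ?thesis
    using L2_inner_disc_holomorphic_monomial[OF assms, of n] unfolding disc_coeff_inverse
    by (simp only: mult_cancel_left) blast
qed

lemma disc_partial_sum_L2: "(\<lambda>z. \<Sum>n\<in>I. c n * z ^ n) \<in> L2_on (ball 0 1)" if "finite I"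
  using that by (intro L2_on_sum L2_on_cmult monomial_L2_on_disc)

lemma disc_partial_sum_norm:
  fixes c :: "nat \<Rightarrow> complex"
  assumes "finite I"
  shows "(\<integral>z. (norm (\<Sum>n\<in>I. c n * z ^ n))\<^sup>2 \<partial>lebesgue_on (ball 0 1)) = (\<Sum>n\<in>I. (norm (c n))\<^sup>2 * (pi / (real n + 1)))"
proof -
  let ?p = "\<lambda>z::complex. \<Sum>n\<in>I. c n * z ^ n"
  have "L2_inner (ball 0 1) ?p (\<lambda>w. w ^ n) = c n * of_real (pi / (real n + 1))" if "n \<in> I" for n
  proof -
    have "L2_inner (ball 0 1) (\<lambda>w. w ^ n) ?p = (\<Sum>m\<in>I. cnj (c m) * L2_inner (ball 0 1) (\<lambda>w. w ^ n) (\<lambda>w. w ^ m))"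
      using assms monomial_L2_on_disc by (intro L2_inner_sum_right)
    also have "\<dots> = (\<Sum>m\<in>I. if n = m then cnj (c m) * of_real (pi / (real m + 1)) else 0)"
      unfolding L2_inner_disc_monomials by (intro sum.cong) auto
    also have "\<dots> = cnj (c n) * of_real (pi / (real n + 1))"
      using assms that by simp
    finally show ?thesis by (subst L2_inner_commute) simp
  qed
  hence "L2_inner (ball 0 1) ?p ?p = (\<Sum>n\<in>I. cnj (c n) * (c n * of_real (pi / (real n + 1))))"
    using assms monomial_L2_on_disc disc_partial_sum_L2[OF assms]
    by (subst L2_inner_sum_right) auto
  also have "\<dots> = of_real (\<Sum>n\<in>I. (norm (c n))\<^sup>2 * (pi / (real n + 1)))"
    unfolding of_real_sum by (intro sum.cong) (simp_all only: of_real_mult complex_norm_square mult_ac)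
  finally show ?thesis unfolding L2_inner_self of_real_eq_iff .
qed

text \<open>Bessel's inequality: with \<open>?p\<close> the partial expansion, the inner products of
  \<open>f\<close> with \<open>?p\<close>, of \<open>?p\<close> with \<open>f\<close> and of
  \<open>?p\<close> with itself all equal the sum, so the squared norm of \<open>f - ?p\<close> is
  that of \<open>f\<close> minus the sum.\<close>

lemma disc_bessel:
  assumes f: "f \<in> L2_on (ball 0 1)" and I: "finite I"
  shows "(\<Sum>n\<in>I. (norm (disc_coeff f n))\<^sup>2 * (pi / (real n + 1))) \<le> (\<integral>z. (norm (f z))\<^sup>2 \<partial>lebesgue_on (ball 0 1))"
proof -
  let ?c = "disc_coeff f"
  let ?p = "\<lambda>z. \<Sum>n\<in>I. ?c n * z ^ n"
  let ?s = "\<Sum>n\<in>I. (norm (?c n))\<^sup>2 * (pi / (real n + 1))"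
  let ?N = "\<integral>z. (norm (f z))\<^sup>2 \<partial>lebesgue_on (ball 0 1)"
  have p: "?p \<in> L2_on (ball 0 1)" by (rule disc_partial_sum_L2[OF I])
  have "L2_inner (ball 0 1) f ?p = (\<Sum>n\<in>I. cnj (?c n) * L2_inner (ball 0 1) f (\<lambda>w. w ^ n))"
    using f I monomial_L2_on_disc by (intro L2_inner_sum_right)
  also have "\<dots> = of_real ?s"
  proof -
    show ?thesis unfolding of_real_sum disc_coeff_inverse
      by (intro sum.cong) (simp_all only: of_real_mult complex_norm_square mult_ac)
  qed
  finally have fp: "L2_inner (ball 0 1) f ?p = of_real ?s" .
  hence pf: "L2_inner (ball 0 1) ?p f = of_real ?s"
    by (subst L2_inner_commute) simp
  have pp: "L2_inner (ball 0 1) ?p ?p = of_real ?s"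
    unfolding L2_inner_self disc_partial_sum_norm[OF I] ..
  have "L2_inner (ball 0 1) (\<lambda>z. f z - ?p z) (\<lambda>z. f z - ?p z) = of_real (?N - ?s)"
    using f p by (simp add: L2_inner_diff_left L2_inner_diff_right L2_on_diff fp pf pp L2_inner_self[of _ f])
  hence "(\<integral>z. (norm (f z - ?p z))\<^sup>2 \<partial>lebesgue_on (ball 0 1)) = ?N - ?s"
    unfolding L2_inner_self of_real_eq_iff .
  moreover have "0 \<le> (\<integral>z. (norm (f z - ?p z))\<^sup>2 \<partial>lebesgue_on (ball 0 1))" by simp
  ultimately show ?thesis by linarith
qed

text \<open>Convergence in L2 is extracted from pointwise convergence: each remainder is the
  pointwise limit of finite blocks of the series, whose norms are bounded by a tail of the Bessel
  sum, and Fatou passes this bound to the remainder.\<close>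

lemma disc_coeff_series_L2:
  assumes f: "f \<in> L2_on (ball 0 1)" and P: "P holomorphic_on ball 0 1"
    and sums: "\<And>z. z \<in> ball 0 1 \<Longrightarrow> (\<lambda>n. disc_coeff f n * z ^ n) sums P z"
  shows "P \<in> bergman_space (ball 0 1)"
    and "(\<lambda>N. \<integral>z. (norm (P z - (\<Sum>n<N. disc_coeff f n * z ^ n)))\<^sup>2 \<partial>lebesgue_on (ball 0 1)) \<longlonglongrightarrow> 0"
proof -
  let ?c = "disc_coeff f"
  define t where "t = (\<lambda>n. (norm (?c n))\<^sup>2 * (pi / (real n + 1)))"
  have t0: "0 \<le> t n" for n unfolding t_def by simp
  have summ: "summable t"
    by (rule summableI_nonneg_bounded[of _ "\<integral>z. (norm (f z))\<^sup>2 \<partial>lebesgue_on (ball 0 1)"])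
       (use t0 disc_bessel[OF f] in \<open>auto simp: t_def\<close>)
  have Pm: "P \<in> borel_measurable (lebesgue_on (ball 0 1))"
    using P by (intro holomorphic_on_imp_borel_measurable_lebesgue_on) auto
  \<comment> \<open>The case M = 0 puts \<open>P\<close> itself into L2; letting M grow gives the
    convergence.\<close>
  have key: "(\<lambda>z. P z - (\<Sum>n<M. ?c n * z ^ n)) \<in> L2_on (ball 0 1) \<and>
        (\<integral>z. (norm (P z - (\<Sum>n<M. ?c n * z ^ n)))\<^sup>2 \<partial>lebesgue_on (ball 0 1)) \<le> (\<Sum>n. t (n + M))" for M
  proof -
    let ?p = "\<lambda>N z. (\<Sum>n\<in>{M..<M+N}. ?c n * z ^ n)"
    have 1: "(\<lambda>z. P z - (\<Sum>n<M. ?c n * z ^ n)) \<in> borel_measurable (lebesgue_on (ball 0 1))"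
      using Pm disc_partial_sum_L2[of "{..<M}" ?c] by (intro borel_measurable_diff) (auto simp: L2_on_def)
    have 2: "?p N \<in> L2_on (ball 0 1)" for N by (rule disc_partial_sum_L2) simp
    have 3: "(\<lambda>N. ?p N z) \<longlonglongrightarrow> P z - (\<Sum>n<M. ?c n * z ^ n)" if "z \<in> ball 0 1" for z
    proof -
      have "(\<lambda>n. ?c (n + M) * z ^ (n + M)) sums (P z - (\<Sum>n<M. ?c n * z ^ n))"
        using sums[OF that] by (rule sums_split_initial_segment)
      moreover have "(\<Sum>n<N. ?c (n + M) * z ^ (n + M)) = ?p N z" for N
        using sum.shift_bounds_nat_ivl[of "\<lambda>n. ?c n * z ^ n" 0 M N] by (simp add: lessThan_atLeast0 add.commute)
      ultimately show ?thesis unfolding sums_def by simp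
    qed
    have 4: "(\<integral>z. (norm (?p N z))\<^sup>2 \<partial>lebesgue_on (ball 0 1)) \<le> (\<Sum>n. t (n + M))" for N
    proof -
      have "(\<integral>z. (norm (?p N z))\<^sup>2 \<partial>lebesgue_on (ball 0 1)) = (\<Sum>n\<in>{M..<M+N}. t n)"
        unfolding t_def by (rule disc_partial_sum_norm) simp
      also have "\<dots> = (\<Sum>n<N. t (n + M))"
        using sum.shift_bounds_nat_ivl[of t 0 M N] by (simp add: lessThan_atLeast0 add.commute)
      also have "\<dots> \<le> (\<Sum>n. t (n + M))"
        using summ t0 by (intro sum_le_suminf summable_ignore_initial_segment) auto
      finally show ?thesis .
    qed
    show ?thesis using L2_fatou[OF 1 2 3 4] by blast
  qed
  show "P \<in> bergman_space (ball 0 1)"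
    using key[of 0] P by (simp add: bergman_space_def)
  show "(\<lambda>N. \<integral>z. (norm (P z - (\<Sum>n<N. ?c n * z ^ n)))\<^sup>2 \<partial>lebesgue_on (ball 0 1)) \<longlonglongrightarrow> 0"
  proof (rule tendsto_sandwich[OF _ _ tendsto_const])
    show "(\<lambda>M. \<Sum>n. t (n + M)) \<longlonglongrightarrow> 0" by (rule suminf_exist_split2[OF summ])
    show "\<forall>\<^sub>F N in sequentially. 0 \<le> (\<integral>z. (norm (P z - (\<Sum>n<N. ?c n * z ^ n)))\<^sup>2 \<partial>lebesgue_on (ball 0 1))"
      by simp
    show "\<forall>\<^sub>F N in sequentially. (\<integral>z. (norm (P z - (\<Sum>n<N. ?c n * z ^ n)))\<^sup>2 \<partial>lebesgue_on (ball 0 1)) \<le> (\<Sum>n. t (n + N))"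
      using key by simp
  qed
qed

section \<open>The reproducing kernel of the disc\<close>

definition disc_kernel :: "complex \<Rightarrow> complex \<Rightarrow> complex" where
  "disc_kernel z w = 1 / (of_real pi * (1 - z * cnj w)\<^sup>2)"

text \<open>Each summand is e_n(z) cnj (e_n(w)) for the normalised monomial e_n of degree n; summing
  them is the differentiated geometric series at z cnj w.\<close>

lemma disc_kernel_sums:
  assumes "norm (z * cnj w) < 1"
  shows "(\<lambda>n. of_real ((real n + 1) / pi) * z ^ n * cnj w ^ n) sums disc_kernel z w"
proof -
  have "(\<lambda>n. of_nat (Suc n) * (z * cnj w) ^ n) sums (1 / (1 - z * cnj w)\<^sup>2)"
    by (rule geometric_deriv_sums[OF assms])
  hence "(\<lambda>n. (1 / of_real pi) * (of_nat (Suc n) * (z * cnj w) ^ n)) sums ((1 / of_real pi) * (1 / (1 - z * cnj w)\<^sup>2))"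
    by (rule sums_mult)
  thus ?thesis unfolding disc_kernel_def by (simp add: power_mult_distrib mult_ac add.commute)
qed

text \<open>For fixed z the partial sums of the kernel are bounded by the constant \<open>C\<close>
  for all w in the disc, and \<open>f\<close> is integrable because the disc has finite area;
  dominated convergence therefore allows termwise integration.\<close>

lemma disc_kernel_integral_sums:
  assumes f: "f \<in> L2_on (ball 0 1)" and z: "z \<in> ball 0 1"
  shows "(\<lambda>n. disc_coeff f n * z ^ n) sums (\<integral>w. disc_kernel z w * f w \<partial>lebesgue_on (ball 0 1))"
proof -
  let ?M = "lebesgue_on (ball 0 1 :: complex set)"
  let ?t = "\<lambda>n w. of_real ((real n + 1) / pi) * z ^ n * cnj w ^ n"
  have fi: "integrable ?M f" by (rule L2_on_disc_integrable[OF f])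
  have fm: "f \<in> borel_measurable ?M" using f by (simp add: L2_on_def)
  have z1: "norm z < 1" using z by simp
  define C where "C = (\<Sum>n. (real n + 1) / pi * norm z ^ n)"
  have summC: "summable (\<lambda>n. (real n + 1) / pi * norm z ^ n)"
  proof -
    have "(\<lambda>n. of_nat (Suc n) * (norm z) ^ n) sums (1 / (1 - norm z)\<^sup>2)"
      using z1 by (intro geometric_deriv_sums) simp
    from sums_mult[OF this, of "1/pi"] show ?thesis
      by (intro sums_summable) (simp add: add.commute mult_ac)
  qed
  have bound: "norm (\<Sum>n<N. ?t n w) \<le> C" if "w \<in> ball 0 1" for w N
  proof -
    have "norm (\<Sum>n<N. ?t n w) \<le> (\<Sum>n<N. norm (?t n w))" by (rule norm_sum)
    also have "\<dots> \<le> (\<Sum>n<N. (real n + 1) / pi * norm z ^ n)"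
    proof (rule sum_mono)
      fix n
      have "norm (?t n w) = (real n + 1) / pi * norm z ^ n * norm w ^ n"
        by (simp only: norm_mult norm_power complex_mod_cnj norm_of_real) simp
      also have "\<dots> \<le> (real n + 1) / pi * norm z ^ n * 1"
        using that by (intro mult_left_mono power_le_one) auto
      finally show "norm (?t n w) \<le> (real n + 1) / pi * norm z ^ n" by simp
    qed
    also have "\<dots> \<le> C" unfolding C_def using summC by (intro sum_le_suminf) auto
    finally show ?thesis .
  qed
  have "(\<lambda>N. \<integral>w. (\<Sum>n<N. ?t n w) * f w \<partial>?M) \<longlonglongrightarrow> (\<integral>w. disc_kernel z w * f w \<partial>?M)"
  proof (rule integral_dominated_convergence)
    show "integrable ?M (\<lambda>w. C * norm (f w))" using fi by auto
    have tm: "(\<lambda>w. \<Sum>n<N. ?t n w) \<in> borel_measurable ?M" for N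
      by (intro continuous_imp_measurable_on_sets_lebesgue continuous_intros) auto
    thus 1: "(\<lambda>w. (\<Sum>n<N. ?t n w) * f w) \<in> borel_measurable ?M" for N
      using fm by (intro borel_measurable_times) auto
    have conv: "(\<lambda>N. (\<Sum>n<N. ?t n w) * f w) \<longlonglongrightarrow> disc_kernel z w * f w" if "w \<in> ball 0 1" for w
    proof -
      have "norm (z * cnj w) < 1"
        using z1 that mult_strict_mono'[of "norm z" 1 "norm w" 1] by (simp add: norm_mult)
      from disc_kernel_sums[OF this] show ?thesis
        unfolding sums_def by (intro tendsto_mult_right)
    qed
    thus "AE w in ?M. (\<lambda>N. (\<Sum>n<N. ?t n w) * f w) \<longlonglongrightarrow> disc_kernel z w * f w" by auto
    show "(\<lambda>w. disc_kernel z w * f w) \<in> borel_measurable ?M"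
      by (rule borel_measurable_LIMSEQ_metric[OF 1]) (use conv in auto)
    show "AE w in ?M. norm ((\<Sum>n<N. ?t n w) * f w) \<le> C * norm (f w)" for N
      using bound by (auto simp: norm_mult intro!: mult_right_mono)
  qed
  moreover have "(\<integral>w. (\<Sum>n<N. ?t n w) * f w \<partial>?M) = (\<Sum>n<N. disc_coeff f n * z ^ n)" for N
  proof -
    have "(\<integral>w. (\<Sum>n<N. ?t n w) * f w \<partial>?M) =
        (\<integral>w. (\<Sum>n<N. of_real ((real n + 1) / pi) * z ^ n * (f w * cnj (w ^ n))) \<partial>?M)"
      by (intro Bochner_Integration.integral_cong refl) (simp only: sum_distrib_right complex_cnj_power, simp only: mult_ac)
    also have "\<dots> = (\<Sum>n<N. \<integral>w. of_real ((real n + 1) / pi) * z ^ n * (f w * cnj (w ^ n)) \<partial>?M)"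
      by (intro Bochner_Integration.integral_sum integrable_mult_right L2_integrable_mult L2_on_cnj f monomial_L2_on_disc)
    also have "\<dots> = (\<Sum>n<N. disc_coeff f n * z ^ n)"
      unfolding disc_coeff_def L2_inner_def by (intro sum.cong refl) (simp only: integral_mult_right_zero, simp only: mult_ac)
    finally show ?thesis .
  qed
  ultimately show ?thesis unfolding sums_def by simp
qed

text \<open>The last claim says that f - P is orthogonal to every monomial. It holds because
  \<open>P\<close> is the sum of the power series with coefficients \<open>disc_coeff f\<close>, and
  for a Bergman function \<open>disc_coeff\<close> returns exactly the power series
  coefficients.\<close>

lemma disc_kernel_integral_bergman:
  assumes f: "f \<in> L2_on (ball 0 1)"
  defines "P \<equiv> (\<lambda>z. \<integral>w. disc_kernel z w * f w \<partial>lebesgue_on (ball 0 1))"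
  shows "P \<in> bergman_space (ball 0 1)"
    and "(\<lambda>N. \<integral>z. (norm (P z - (\<Sum>n<N. disc_coeff f n * z ^ n)))\<^sup>2 \<partial>lebesgue_on (ball 0 1)) \<longlonglongrightarrow> 0"
    and "disc_coeff P n = disc_coeff f n"
proof -
  have sums: "(\<lambda>n. disc_coeff f n * z ^ n) sums P z" if "z \<in> ball 0 1" for z
    unfolding P_def by (rule disc_kernel_integral_sums[OF f that])
  have hol: "P holomorphic_on ball 0 1"
    by (rule power_series_holomorphic[of 0 1 "disc_coeff f"]) (use sums in simp)
  show PA: "P \<in> bergman_space (ball 0 1)"
    and "(\<lambda>N. \<integral>z. (norm (P z - (\<Sum>n<N. disc_coeff f n * z ^ n)))\<^sup>2 \<partial>lebesgue_on (ball 0 1)) \<longlonglongrightarrow> 0"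
    using disc_coeff_series_L2[OF f hol sums] by blast+
  have "P has_fps_expansion Abs_fps (disc_coeff f)"
  proof (rule has_fps_expansionI)
    have "eventually (\<lambda>u. u \<in> ball (0::complex) 1) (nhds 0)"
      by (intro eventually_nhds_in_open) auto
    thus "\<forall>\<^sub>F u in nhds 0. (\<lambda>n. fps_nth (Abs_fps (disc_coeff f)) n * u ^ n) sums P u"
      by eventually_elim (use sums in simp)
  qed
  from fps_nth_fps_expansion[OF this, of n]
  have "(deriv ^^ n) P 0 / fact n = disc_coeff f n" by simp
  thus "disc_coeff P n = disc_coeff f n"
    using disc_coeff_holomorphic[OF PA, of n] by simp
qed

text \<open>Both sides are the sum of the Taylor series of \<open>h\<close>. It identifies the L2
  limit of the Taylor polynomials with \<open>h\<close>, which is the completeness of the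
  monomials.\<close>

lemma disc_kernel_reproducing:
  assumes h: "h \<in> bergman_space (ball 0 1)" and z: "z \<in> ball 0 1"
  shows "(\<integral>w. disc_kernel z w * h w \<partial>lebesgue_on (ball 0 1)) = h z"
proof -
  have "(\<lambda>n. (deriv ^^ n) h 0 / fact n * (z - 0) ^ n) sums h z"
    using h z by (intro holomorphic_power_series[of _ _ 1]) (auto simp: bergman_space_def)
  moreover have "(\<lambda>n. disc_coeff h n * z ^ n) sums (\<integral>w. disc_kernel z w * h w \<partial>lebesgue_on (ball 0 1))"
    using h z by (intro disc_kernel_integral_sums) (auto simp: bergman_space_def)
  ultimately show ?thesis
    unfolding disc_coeff_holomorphic[OF h] by (simp add: sums_unique2)
qed

text \<open>For fixed z the denominator stays away from 0 because |1 - cnj z w| >= 1 - |z|, so the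
  function is bounded on the disc.\<close>

lemma disc_kernel_bergman_space:
  assumes z: "z \<in> ball 0 1"
  shows "(\<lambda>w. cnj (disc_kernel z w)) \<in> bergman_space (ball 0 1)"
proof -
  have z1: "norm z < 1" using z by simp
  have le: "1 - norm z \<le> norm (1 - cnj z * w)" if "w \<in> ball 0 1" for w
  proof -
    have "norm (cnj z * w) \<le> norm z * 1"
      unfolding norm_mult complex_mod_cnj using that by (intro mult_left_mono) auto
    moreover have "norm (1::complex) - norm (cnj z * w) \<le> norm (1 - cnj z * w)"
      by (rule norm_triangle_ineq2)
    ultimately show ?thesis by simp
  qed
  have eq: "(\<lambda>w. cnj (disc_kernel z w)) = (\<lambda>w. 1 / (of_real pi * (1 - cnj z * w)\<^sup>2))"
    by (simp add: disc_kernel_def)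
  have nz: "1 - cnj z * w \<noteq> 0" if "w \<in> ball 0 1" for w
    using le[OF that] z1 by auto
  have hol: "(\<lambda>w. 1 / (of_real pi * (1 - cnj z * w)\<^sup>2)) holomorphic_on ball 0 1"
    using nz by (intro holomorphic_intros) auto
  moreover have "(\<lambda>w. 1 / (of_real pi * (1 - cnj z * w)\<^sup>2)) \<in> L2_on (ball 0 1)"
  proof (rule L2_on_disc_bounded)
    show "(\<lambda>w. 1 / (of_real pi * (1 - cnj z * w)\<^sup>2)) \<in> borel_measurable (lebesgue_on (ball 0 1))"
      using hol by (intro holomorphic_on_imp_borel_measurable_lebesgue_on) auto
    fix w :: complex assume w: "w \<in> ball 0 1"
    have "(1 - norm z)\<^sup>2 \<le> (norm (1 - cnj z * w))\<^sup>2"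
      using le[OF w] z1 by (intro power_mono) auto
    thus "norm (1 / (of_real pi * (1 - cnj z * w)\<^sup>2)) \<le> 1 / (pi * (1 - norm z)\<^sup>2)"
      using z1 nz[OF w] by (simp add: norm_divide norm_mult norm_power frac_le)
  qed
  ultimately show ?thesis unfolding eq by (simp add: bergman_space_def)
qed

text \<open>The error \<open>f - P\<close> is orthogonal to all monomials, hence to the Taylor polynomials of \<open>h\<close>, and
  these converge to \<open>h\<close> in \<open>L\<^sup>2\<close>.\<close>

theorem is_bergman_kernel_disc: "is_bergman_kernel (ball 0 1) disc_kernel"
  unfolding is_bergman_kernel_def is_bergman_projection_def
proof (intro conjI ballI)
  fix f assume f: "f \<in> L2_on (ball 0 1)"
  define P where "P = (\<lambda>z. \<integral>w. disc_kernel z w * f w \<partial>lebesgue_on (ball 0 1))"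
  note P = disc_kernel_integral_bergman[OF f, folded P_def]
  show "(\<lambda>z. \<integral>w. disc_kernel z w * f w \<partial>lebesgue_on (ball 0 1)) \<in> bergman_space (ball 0 1)"
    using P(1) unfolding P_def .
  fix h assume h: "h \<in> bergman_space (ball 0 1)"
  let ?u = "\<lambda>z. f z - P z"
  have u: "?u \<in> L2_on (ball 0 1)"
    using f P(1) by (intro L2_on_diff) (auto simp: bergman_space_def)
  have hL: "h \<in> L2_on (ball 0 1)" using h by (simp add: bergman_space_def)
  let ?s = "\<lambda>N z. \<Sum>n<N. disc_coeff h n * z ^ n"
  have sL: "?s N \<in> L2_on (ball 0 1)" for N by (rule disc_partial_sum_L2) simp
  have mono: "L2_inner (ball 0 1) ?u (\<lambda>w. w ^ n) = 0" for n
  proof -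
    have "of_real ((real n + 1) / pi) * L2_inner (ball 0 1) ?u (\<lambda>w. w ^ n) = disc_coeff f n - disc_coeff P n"
      using f P(1) monomial_L2_on_disc
      by (subst L2_inner_diff_left) (auto simp: disc_coeff_def bergman_space_def right_diff_distrib)
    also have "\<dots> = 0" by (simp add: P(3))
    finally show ?thesis
      using of_nat_neq_0[of n, where ?'a = complex] by (auto simp: add.commute)
  qed
  have "L2_inner (ball 0 1) ?u (?s N) = 0" for N
    by (subst L2_inner_sum_right) (auto simp: monomial_L2_on_disc u mono)
  hence const: "L2_inner (ball 0 1) ?u (\<lambda>z. h z - ?s N z) = L2_inner (ball 0 1) ?u h" for N
    using hL sL[of N] u by (subst L2_inner_diff_right) auto
  have "(\<integral>z. (norm ((\<integral>w. disc_kernel z w * h w \<partial>lebesgue_on (ball 0 1)) - ?s N z))\<^sup>2 \<partial>lebesgue_on (ball 0 1))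
      = (\<integral>z. (norm (h z - ?s N z))\<^sup>2 \<partial>lebesgue_on (ball 0 1))" for N
    by (intro Bochner_Integration.integral_cong refl) (simp add: disc_kernel_reproducing[OF h])
  hence "(\<lambda>N. \<integral>z. (norm (h z - ?s N z))\<^sup>2 \<partial>lebesgue_on (ball 0 1)) \<longlonglongrightarrow> 0"
    using disc_kernel_integral_bergman(2)[OF hL] by simp
  hence "(\<lambda>N. L2_inner (ball 0 1) ?u (\<lambda>z. h z - ?s N z)) \<longlonglongrightarrow> 0"
    by (intro L2_inner_tendsto_0[OF u] L2_on_diff[OF hL sL])
  hence "L2_inner (ball 0 1) ?u h = 0"
    unfolding const by (simp add: LIMSEQ_const_iff)
  thus "L2_inner (ball 0 1) (\<lambda>z. f z - (\<integral>w. disc_kernel z w * f w \<partial>lebesgue_on (ball 0 1))) h = 0"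
    by (simp only: P_def)
qed (rule disc_kernel_bergman_space)

section \<open>Geometry of the periodic domain\<close>

text \<open>A Lipschitz domain lies on one side only of its boundary: points below the local graph
  are not in the closure, so no boundary point is interior to the closure.\<close>

lemma lipschitz_domain_interior_closure:
  assumes "lipschitz_domain \<Omega>"
  shows "interior (closure \<Omega>) = \<Omega>"
proof
  have op: "open \<Omega>" using assms by (simp add: lipschitz_domain_def)
  thus "\<Omega> \<subseteq> interior (closure \<Omega>)" by (simp add: interior_maximal closure_subset)
  show "interior (closure \<Omega>) \<subseteq> \<Omega>"
  proof
    fix p assume p: "p \<in> interior (closure \<Omega>)"
    show "p \<in> \<Omega>"
    proof (rule ccontr)
      assume np: "p \<notin> \<Omega>"
      hence "p \<in> frontier \<Omega>"
        using p op interior_subset by (auto simp: frontier_def interior_open)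
      then obtain r c L g where r: "r > 0" and c: "norm c = 1" and L: "L-lipschitz_on UNIV (g :: real \<Rightarrow> real)"
        and graph: "\<And>z. z \<in> ball p r \<Longrightarrow> z \<in> \<Omega> \<longleftrightarrow> g (Re (cnj c * (z - p))) < Im (cnj c * (z - p))"
        using assms unfolding lipschitz_domain_def by meson
      have contg: "continuous_on A g" for A
        using lipschitz_on_continuous_on[OF L] continuous_on_subset by blast
      have g0: "0 \<le> g 0" using graph[of p] np r by auto
      obtain e where e: "e > 0" "ball p e \<subseteq> closure \<Omega>" using p mem_interior by blast
      define s where "s = min r e / 2"
      have s: "0 < s" "s < r" "s < e" using r e by (auto simp: s_def)
      \<comment> \<open>The point at distance s straight below \<open>p\<close> in the rotated
        coordinates. It is below the graph since \<open>p\<close>, not being in the domain, forces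
        \<open>0 \<le> g 0\<close>.\<close>
      define z where "z = p - of_real s * \<i> * c"
      have zp: "cnj c * (z - p) = - (of_real s * \<i>)"
        using complex_norm_square[of c] c by (simp add: z_def mult_ac)
      let ?V = "ball p r \<inter> {z. Im (cnj c * (z - p)) < g (Re (cnj c * (z - p)))}"
      have "open {z. Im (cnj c * (z - p)) < g (Re (cnj c * (z - p)))}"
        by (intro open_Collect_less continuous_intros continuous_on_compose2[OF contg]) auto
      hence "open ?V" by auto
      moreover have "?V \<inter> \<Omega> = {}" using graph by fastforce
      ultimately have "?V \<inter> closure \<Omega> = {}" using open_Int_closure_eq_empty by blast
      moreover have "z \<in> ball p r" "z \<in> ball p e"
        using s c by (auto simp: z_def dist_norm norm_mult)
      moreover have "Im (cnj c * (z - p)) < g (Re (cnj c * (z - p)))"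
        unfolding zp using s g0 by simp
      ultimately show False using e(2) by blast
    qed
  qed
qed

text \<open>The local graph contains a vertical segment through \<open>p\<close>, which forces the Lipschitz function
  to be linear near \<open>0\<close> and the boundary to be that segment.\<close>

lemma lipschitz_domain_half_ball:
  assumes lip: "lipschitz_domain \<Omega>" and side: "\<And>z. z \<in> \<Omega> \<Longrightarrow> 0 < s * Re (z - p)"
    and e0: "0 < e0" and fr: "\<And>v. \<bar>v\<bar> < e0 \<Longrightarrow> p + of_real v * \<i> \<in> closure \<Omega>"
  obtains e where "0 < e" "\<And>z. z \<in> ball p e \<Longrightarrow> z \<in> \<Omega> \<longleftrightarrow> 0 < s * Re (z - p)"
proof -
  have op: "open \<Omega>" using lip by (simp add: lipschitz_domain_def)
  have nin: "p + of_real v * \<i> \<notin> \<Omega>" for v using side[of "p + of_real v * \<i>"] by auto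
  have "p \<in> frontier \<Omega>"
    using fr[of 0] nin[of 0] e0 op by (auto simp: frontier_def interior_open)
  then obtain r c L g where r: "r > 0" and c: "norm c = 1" and L: "L-lipschitz_on UNIV (g :: real \<Rightarrow> real)"
    and graph: "\<And>z. z \<in> ball p r \<Longrightarrow> z \<in> \<Omega> \<longleftrightarrow> g (Re (cnj c * (z - p))) < Im (cnj c * (z - p))"
    using lip unfolding lipschitz_domain_def by meson
  have contg: "continuous_on A g" for A
    using lipschitz_on_continuous_on[OF L] continuous_on_subset by blast
  define x y where "x = Re c" and "y = Im c"
  have xy: "x\<^sup>2 + y\<^sup>2 = 1" using c by (simp add: x_def y_def cmod_def)
  have Re_c: "Re (cnj c * w) = x * Re w + y * Im w" and Im_c: "Im (cnj c * w) = x * Im w - y * Re w" for w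
    by (simp_all add: x_def y_def)
  define e1 where "e1 = min e0 r"
  have e1: "0 < e1" using e0 r by (simp add: e1_def)
  \<comment> \<open>In the rotated coordinates p + v i has abscissa y v and ordinate x v. It is not
    in the domain, hence not above the graph; it is in the closure, hence not strictly below
    it.\<close>
  have line: "g (y * v) = x * v" if v: "\<bar>v\<bar> < e1" for v
  proof (rule antisym)
    let ?q = "p + of_real v * \<i>"
    have q: "?q \<in> ball p r" using v by (simp add: e1_def dist_norm norm_mult)
    have qp: "Re (cnj c * (?q - p)) = y * v" "Im (cnj c * (?q - p)) = x * v"
      unfolding Re_c Im_c by simp_all
    show "x * v \<le> g (y * v)" using graph[OF q] nin[of v] unfolding qp by simp
    show "g (y * v) \<le> x * v"
    proof (rule ccontr)
      assume "\<not> g (y * v) \<le> x * v"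
      let ?V = "ball p r \<inter> {z. Im (cnj c * (z - p)) < g (Re (cnj c * (z - p)))}"
      have "open {z. Im (cnj c * (z - p)) < g (Re (cnj c * (z - p)))}"
        by (intro open_Collect_less continuous_intros continuous_on_compose2[OF contg]) auto
      hence "open ?V" by auto
      moreover have "?V \<inter> \<Omega> = {}" using graph by fastforce
      ultimately have "?V \<inter> closure \<Omega> = {}" using open_Int_closure_eq_empty by blast
      moreover have "?q \<in> ?V" using q \<open>\<not> g (y * v) \<le> x * v\<close> unfolding Int_iff mem_Collect_eq qp by simp
      moreover have "?q \<in> closure \<Omega>" using fr v by (simp add: e1_def)
      ultimately show False by blast
    qed
  qed
  \<comment> \<open>For y = 0 the segment would be vertical in the rotated coordinates and could not
    lie on a graph.\<close>
  have y: "y \<noteq> 0"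
  proof
    assume "y = 0"
    hence "x * (e1/2) = x * 0" using line[of "e1/2"] line[of 0] e1 by simp
    hence "x = 0" using e1 by simp
    thus False using xy \<open>y = 0\<close> by simp
  qed
  define e where "e = min r (\<bar>y\<bar> * e1)"
  have e: "0 < e" using r y e1 by (simp add: e_def)
  have loc: "z \<in> \<Omega> \<longleftrightarrow> y * Re (z - p) < 0" if z: "z \<in> ball p e" for z
  proof -
    define u v where "u = Re (z - p)" and "v = Im (z - p)"
    define t where "t = x * u + y * v"
    have zr: "z \<in> ball p r" using z by (simp add: e_def)
    have "\<bar>t\<bar> \<le> norm (cnj c * (z - p))"
      unfolding t_def u_def v_def Re_c[symmetric] by (rule abs_Re_le_cmod)
    also have "\<dots> < \<bar>y\<bar> * e1" using z c by (simp add: norm_mult e_def dist_norm norm_minus_commute)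
    finally have "\<bar>t / y\<bar> < e1" using y by (simp add: abs_divide pos_divide_less_eq mult.commute)
    hence "g t = x * (t / y)" using line[of "t / y"] y by simp
    hence "z \<in> \<Omega> \<longleftrightarrow> x * (t / y) < x * v - y * u"
      using graph[OF zr] unfolding Re_c Im_c u_def[symmetric] v_def[symmetric] t_def[symmetric] by simp
    also have "x * v - y * u = x * (t / y) - u / y"
    proof -
      have "x * t = x * x * u + x * y * v" by (simp add: t_def algebra_simps)
      also have "x * x = 1 - y * y" using xy by (simp add: power2_eq_square)
      finally show ?thesis using y by (simp add: field_simps)
    qed
    also have "x * (t / y) < x * (t / y) - u / y \<longleftrightarrow> u / y < 0" by simp
    also have "\<dots> \<longleftrightarrow> y * u < 0" by (auto simp: divide_less_0_iff mult_less_0_iff)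
    finally show ?thesis by (simp add: u_def)
  qed
  \<comment> \<open>The local description \<open>loc\<close> leaves the side open. This
    \<open>z0\<close> is a sample point of the domain; the hypothesis \<open>side\<close> at
    \<open>z0\<close> forces s and y to have opposite signs.\<close>
  define z0 where "z0 = p - of_real (sgn y * (e / 2))"
  have "z0 \<in> ball p e" using e y by (simp add: z0_def dist_norm norm_mult abs_mult abs_sgn_eq)
  moreover have "y * Re (z0 - p) < 0" using e y by (simp add: z0_def mult.assoc[symmetric] abs_sgn[symmetric])
  ultimately have "0 < s * Re (z0 - p)" using loc side by blast
  hence sy: "s * sgn y < 0" using e by (simp add: z0_def mult.assoc[symmetric] zero_less_mult_iff mult_less_0_iff)
  have "y * u < 0 \<longleftrightarrow> 0 < s * u" for u
    using sy by (auto simp: sgn_real_def mult_less_0_iff zero_less_mult_iff split: if_splits)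
  thus thesis using that[OF e] loc by blast
qed

text \<open>Near a point z0, continuity keeps the imaginary part of s(z) - s(z0) below 1 in modulus,
  so this difference is the principal logarithm of exp (s(z) - s(z0)), which is holomorphic.\<close>

lemma continuous_exp_holomorphic:
  fixes s :: "complex \<Rightarrow> complex"
  assumes A: "open A" and s: "continuous_on A s" and hol: "(\<lambda>z. exp (s z)) holomorphic_on A"
  shows "s holomorphic_on A"
proof (rule holomorphic_onI)
  fix z0 assume z0: "z0 \<in> A"
  obtain e1 where e1: "0 < e1" "ball z0 e1 \<subseteq> A" using A z0 open_contains_ball by blast
  obtain e2 where e2: "0 < e2" "\<And>z. z \<in> A \<Longrightarrow> dist z z0 < e2 \<Longrightarrow> dist (s z) (s z0) < 1"
    using s z0 zero_less_one unfolding continuous_on_iff by metis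
  define e where "e = min e1 e2"
  have e: "0 < e" "ball z0 e \<subseteq> A" using e1 e2 by (auto simp: e_def)
  have close: "\<bar>Im (s z - s z0)\<bar> < 1" if "z \<in> ball z0 e" for z
  proof -
    have "z \<in> A" "dist z z0 < e2" using that e(2) by (auto simp: e_def dist_commute)
    hence "dist (s z) (s z0) < 1" by (rule e2(2))
    thus ?thesis using abs_Im_le_cmod[of "s z - s z0"] by (simp add: dist_norm)
  qed
  have quot: "exp (s z) * exp (- s z0) = exp (s z - s z0)" for z
    by (simp add: exp_diff exp_minus divide_inverse)
  have pos: "exp (s z) * exp (- s z0) \<notin> \<real>\<^sub>\<le>\<^sub>0" if "z \<in> ball z0 e" for z
  proof -
    have "\<bar>Im (s z - s z0)\<bar> < pi / 2" using close[OF that] pi_gt3 by linarith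
    hence "0 < cos (Im (s z - s z0))" by (intro cos_gt_zero_pi) linarith+
    hence "0 < Re (exp (s z - s z0))" unfolding Re_exp by simp
    thus ?thesis unfolding quot by (auto simp: complex_nonpos_Reals_iff)
  qed
  have "(\<lambda>z. s z0 + Ln (exp (s z) * exp (- s z0))) holomorphic_on ball z0 e"
    using pos by (intro holomorphic_intros holomorphic_on_subset[OF hol e(2)]) auto
  hence "s holomorphic_on ball z0 e"
  proof (rule holomorphic_transform)
    fix z assume "z \<in> ball z0 e"
    from close[OF this] have "Ln (exp (s z - s z0)) = s z - s z0"
      using pi_gt3 by (intro Ln_exp) linarith+
    thus "s z0 + Ln (exp (s z) * exp (- s z0)) = s z" unfolding quot by simp
  qed
  hence "s field_differentiable (at z0)"
    using e(1) by (auto simp: holomorphic_on_open field_differentiable_def)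
  thus "s field_differentiable (at z0 within A)"
    using field_differentiable_at_within by blast
qed

section \<open>Gluing of neighbouring cells\<close>

locale cell =
  fixes \<omega> :: "complex set" and M a b :: real
  assumes cell: "periodic_cell \<omega> M a b"
begin

lemma lip: "lipschitz_domain \<omega>"
  using cell by (simp add: periodic_cell_def)

lemma open_cell: "open \<omega>"
  using lip by (simp add: lipschitz_domain_def)

lemma cell_Re: "z \<in> \<omega> \<Longrightarrow> 0 < Re z \<and> Re z < 1"
  using cell by (auto simp: periodic_cell_def)

lemma closure_cell_Re:
  assumes "z \<in> closure \<omega>"
  shows "0 \<le> Re z \<and> Re z \<le> 1"
proof -
  have "closure \<omega> \<subseteq> {z. 0 \<le> Re z} \<inter> {z. Re z \<le> 1}"
    using cell_Re by (intro closure_minimal closed_Int closed_halfspace_Re_ge closed_halfspace_Re_le) force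
  thus ?thesis using assms by auto
qed

lemma closure_cell_left: "Re z = 0 \<Longrightarrow> z \<in> closure \<omega> \<longleftrightarrow> a \<le> Im z \<and> Im z \<le> b"
  and closure_cell_right: "Re z = 1 \<Longrightarrow> z \<in> closure \<omega> \<longleftrightarrow> a \<le> Im z \<and> Im z \<le> b"
  using cell unfolding periodic_cell_def set_eq_iff by blast+

lemma J_plus_iff: "z \<in> J_plus a b \<longleftrightarrow> z - 1 \<in> J_minus a b"
  by (auto simp: J_plus_def J_minus_def)

lemma half_ball_left:
  assumes p: "p \<in> J_minus a b"
  obtains e where "0 < e" "\<And>z. z \<in> ball p e \<Longrightarrow> z \<in> \<omega> \<longleftrightarrow> 0 < Re z"
proof (rule lipschitz_domain_half_ball[OF lip, of 1 p "min (Im p - a) (b - Im p)"])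
  show "p + of_real v * \<i> \<in> closure \<omega>" if "\<bar>v\<bar> < min (Im p - a) (b - Im p)" for v
    using that p by (subst closure_cell_left) (auto simp: J_minus_def)
qed (use p cell_Re that in \<open>auto simp: J_minus_def\<close>)

lemma half_ball_right:
  assumes p: "p \<in> J_plus a b"
  obtains e where "0 < e" "\<And>z. z \<in> ball p e \<Longrightarrow> z \<in> \<omega> \<longleftrightarrow> Re z < 1"
proof (rule lipschitz_domain_half_ball[OF lip, of "-1" p "min (Im p - a) (b - Im p)"])
  show "p + of_real v * \<i> \<in> closure \<omega>" if "\<bar>v\<bar> < min (Im p - a) (b - Im p)" for v
    using that p by (subst closure_cell_right) (auto simp: J_plus_def)
qed (use p cell_Re that in \<open>auto simp: J_plus_def\<close>)

text \<open>The local picture at the seam: the right half of a small ball lies in the cell itself,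
  the left half in the cell shifted by -1, where it belongs to the part near the right edge.\<close>

lemma J_minus_nhd:
  assumes p: "p \<in> J_minus a b"
  obtains e where "0 < e" "e < 1 / 2"
    "\<And>z. z \<in> ball p e \<Longrightarrow> 0 < Re z \<Longrightarrow> z \<in> cell_minus \<omega>"
    "\<And>z. z \<in> ball p e \<Longrightarrow> Re z < 0 \<Longrightarrow> z + 1 \<in> cell_plus \<omega>"
    "\<And>z. z \<in> ball p e \<Longrightarrow> Re z = 0 \<Longrightarrow> z \<in> J_minus a b"
proof -
  obtain e1 where e1: "0 < e1" "\<And>z. z \<in> ball p e1 \<Longrightarrow> z \<in> \<omega> \<longleftrightarrow> 0 < Re z"
    using half_ball_left[OF p] by blast
  have "p + 1 \<in> J_plus a b" using p by (simp add: J_plus_iff)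
  then obtain e2 where e2: "0 < e2" "\<And>z. z \<in> ball (p + 1) e2 \<Longrightarrow> z \<in> \<omega> \<longleftrightarrow> Re z < 1"
    using half_ball_right by blast
  \<comment> \<open>The bound 1/4 keeps the right half below \<open>Re z = 1/2\<close> and the
    shifted left half above it; the last two entries keep the central segment inside
    \<open>J_minus\<close>.\<close>
  define e where "e = Min {e1, e2, 1/4, Im p - a, b - Im p}"
  have e: "0 < e" "e \<le> e1" "e \<le> e2" "e \<le> 1/4" "e \<le> Im p - a" "e \<le> b - Im p"
    using e1(1) e2(1) p unfolding e_def J_minus_def by (simp, (intro Min_le; simp)+)
  have p0: "Re p = 0" using p by (simp add: J_minus_def)
  have near: "\<bar>Re z\<bar> < e" "\<bar>Im z - Im p\<bar> < e" if "z \<in> ball p e" for z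
    using that abs_Re_le_cmod[of "z - p"] abs_Im_le_cmod[of "z - p"] p0
    by (auto simp: dist_norm norm_minus_commute)
  show thesis
  proof (rule that[OF e(1)])
    show "e < 1 / 2" using e by simp
  next
    fix z assume z: "z \<in> ball p e"
    show "z \<in> cell_minus \<omega>" if "0 < Re z"
      using that z e e1(2)[of z] near[OF z] by (auto simp: cell_minus_def cell_plus_def)
    show "z + 1 \<in> cell_plus \<omega>" if "Re z < 0"
      using that z e e2(2)[of "z + 1"] near[OF z] by (auto simp: cell_plus_def)
    show "z \<in> J_minus a b" if "Re z = 0"
      using that e near[OF z] by (auto simp: J_minus_def)
  qed
qed

lemma periodic_domain_eq:
  "periodic_domain \<omega> = interior {z. \<exists>m::int. z - of_int m \<in> closure \<omega>}"
proof -
  have "closure ((\<lambda>z. z + of_int m) ` \<omega>) = (\<lambda>z. z + of_int m) ` closure \<omega>" for m :: int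
    using closure_translation[of "of_int m" \<omega>] by (simp add: add.commute)
  moreover have "(\<Union>m::int. (\<lambda>z. z + of_int m) ` closure \<omega>) = {z. \<exists>m::int. z - of_int m \<in> closure \<omega>}"
  proof (intro set_eqI iffI)
    fix z assume "z \<in> (\<Union>m::int. (\<lambda>z. z + of_int m) ` closure \<omega>)"
    then obtain m :: int and v where "v \<in> closure \<omega>" "z = v + of_int m" by blast
    hence "z - of_int m \<in> closure \<omega>" by simp
    thus "z \<in> {z. \<exists>m::int. z - of_int m \<in> closure \<omega>}" by blast
  next
    fix z assume "z \<in> {z. \<exists>m::int. z - of_int m \<in> closure \<omega>}"
    then obtain m :: int where "z - of_int m \<in> closure \<omega>" by blast
    moreover have "z = (z - of_int m) + of_int m" by simp
    ultimately show "z \<in> (\<Union>m::int. (\<lambda>z. z + of_int m) ` closure \<omega>)" by blast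
  qed
  ultimately show ?thesis unfolding periodic_domain_def by simp
qed

text \<open>With the converse below, the periodic domain consists of the integer translates of
  \<open>\<omega> \<union> J_minus a b\<close>. \<open>J_plus\<close> is left out, being a translate
  of \<open>J_minus\<close>.\<close>

lemma in_periodic_domainI:
  assumes z: "z - of_int m \<in> \<omega> \<union> J_minus a b"
  shows "z \<in> periodic_domain \<omega>"
proof -
  let ?U = "{z. \<exists>m::int. z - of_int m \<in> closure \<omega>}"
  have "\<exists>e>0. ball (z - of_int m) e \<subseteq> ?U"
  proof (cases "z - of_int m \<in> \<omega>")
    case True
    then obtain e where "e > 0" "ball (z - of_int m) e \<subseteq> \<omega>" using open_cell open_contains_ball by blast
    moreover have "\<omega> \<subseteq> ?U"
    proof
      fix v assume "v \<in> \<omega>"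
      hence "v - of_int 0 \<in> closure \<omega>" using closure_subset by auto
      thus "v \<in> ?U" by blast
    qed
    ultimately show ?thesis by blast
  next
    case False
    with z have J: "z - of_int m \<in> J_minus a b" by blast
    obtain e where e: "0 < e" "e < 1 / 2"
      "\<And>v. v \<in> ball (z - of_int m) e \<Longrightarrow> 0 < Re v \<Longrightarrow> v \<in> cell_minus \<omega>"
      "\<And>v. v \<in> ball (z - of_int m) e \<Longrightarrow> Re v < 0 \<Longrightarrow> v + 1 \<in> cell_plus \<omega>"
      "\<And>v. v \<in> ball (z - of_int m) e \<Longrightarrow> Re v = 0 \<Longrightarrow> v \<in> J_minus a b"
      by (rule J_minus_nhd[OF J]) (rule that)
    have "v \<in> ?U" if v: "v \<in> ball (z - of_int m) e" for v
    proof (cases "Re v" "0::real" rule: linorder_cases)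
      case less
      hence "v - of_int (-1) \<in> closure \<omega>" using e(4)[OF v] closure_subset by (auto simp: cell_plus_def)
      thus ?thesis by blast
    next
      case equal
      hence "v - of_int 0 \<in> closure \<omega>" using e(5)[OF v] closure_cell_left[of v] by (auto simp: J_minus_def)
      thus ?thesis by blast
    next
      case greater
      hence "v - of_int 0 \<in> closure \<omega>" using e(3)[OF v] closure_subset by (auto simp: cell_minus_def)
      thus ?thesis by blast
    qed
    thus ?thesis using e(1) by blast
  qed
  then obtain e where e: "e > 0" "ball (z - of_int m) e \<subseteq> ?U" by blast
  have "ball z e \<subseteq> ?U"
  proof
    fix v assume "v \<in> ball z e"
    hence "v - of_int m \<in> ball (z - of_int m) e" by (simp add: dist_norm)
    then obtain k :: int where "v - of_int m - of_int k \<in> closure \<omega>" using e(2) by blast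
    hence "v - of_int (m + k) \<in> closure \<omega>" by (simp add: algebra_simps)
    thus "v \<in> ?U" by blast
  qed
  thus ?thesis unfolding periodic_domain_eq mem_interior using e(1) by blast
qed

text \<open>Two kinds of points of the closed cell have to be excluded from the interior: those over
  \<open>Re z = 0\<close> that are not in the open segment, and boundary points inside the open
  vertical strip. The latter are excluded by
  \<open>lipschitz_domain_interior_closure\<close>.\<close>

lemma in_periodic_domainD:
  assumes "z \<in> periodic_domain \<omega>"
  shows "z - of_int \<lfloor>Re z\<rfloor> \<in> \<omega> \<union> J_minus a b"
proof -
  let ?U = "{z. \<exists>m::int. z - of_int m \<in> closure \<omega>}"
  define m where "m = \<lfloor>Re z\<rfloor>"
  define z' where "z' = z - of_int m"
  have r: "0 \<le> Re z'" "Re z' < 1" unfolding z'_def m_def by (simp_all, linarith+)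
  obtain e where e: "e > 0" "ball z e \<subseteq> ?U"
    using assms unfolding periodic_domain_eq mem_interior by blast
  have e': "ball z' e \<subseteq> ?U"
  proof
    fix v assume "v \<in> ball z' e"
    hence "v + of_int m \<in> ball z e" by (simp add: dist_norm z'_def algebra_simps)
    then obtain k :: int where "v + of_int m - of_int k \<in> closure \<omega>" using e(2) by blast
    hence "v - of_int (k - m) \<in> closure \<omega>" by (simp add: algebra_simps)
    thus "v \<in> ?U" by blast
  qed
  show ?thesis
  proof (cases "Re z' = 0")
    case True
    \<comment> \<open>A vertical neighbour lies in the closed cell on the right
      (\<open>k = 0\<close>) or on the left (\<open>k = -1\<close>), and both meet the line in the
      same segment. Freedom to move up and down then makes the bounds strict.\<close>
    have *: "a \<le> Im z' + t \<and> Im z' + t \<le> b" if "\<bar>t\<bar> < e" for t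
    proof -
      define v where "v = z' + of_real t * \<i>"
      have "v \<in> ball z' e" using that by (simp add: v_def dist_norm norm_mult)
      then obtain k :: int where k: "v - of_int k \<in> closure \<omega>" using e' by blast
      have Rv: "Re (v - of_int k) = - of_int k" using True by (simp add: v_def)
      hence "k = 0 \<or> k = -1" using closure_cell_Re[OF k] by linarith
      thus ?thesis
      proof
        assume "k = 0"
        thus ?thesis using k Rv closure_cell_left[of v] by (simp add: v_def)
      next
        assume "k = -1"
        thus ?thesis using k Rv closure_cell_right[of "v + 1"] by (simp add: v_def)
      qed
    qed
    have "a < Im z'" "Im z' < b" using *[of "e/2"] *[of "- e/2"] e(1) by auto
    thus ?thesis using True by (simp add: J_minus_def z'_def m_def)
  next
    case False
    define d where "d = Min {e, Re z', 1 - Re z'}"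
    have d: "0 < d" "d \<le> e" "d \<le> Re z'" "d \<le> 1 - Re z'" using e r False by (auto simp: d_def)
    have "ball z' d \<subseteq> closure \<omega>"
    proof
      fix v assume v: "v \<in> ball z' d"
      have "\<bar>Re v - Re z'\<bar> < d" using v abs_Re_le_cmod[of "v - z'"] by (auto simp: dist_norm norm_minus_commute)
      hence Rv: "0 < Re v" "Re v < 1" using d by linarith+
      have "v \<in> ball z' e" using v d by simp
      then obtain k :: int where k: "v - of_int k \<in> closure \<omega>" using e' by blast
      have "k = 0" using closure_cell_Re[OF k] Rv by simp
      thus "v \<in> closure \<omega>" using k by simp
    qed
    hence "z' \<in> interior (closure \<omega>)" using d(1) mem_interior by blast
    thus ?thesis using lipschitz_domain_interior_closure[OF lip] by (simp add: z'_def m_def)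
  qed
qed

lemma open_periodic_domain: "open (periodic_domain \<omega>)"
  by (simp add: periodic_domain_def)

lemma ring_domain_eq: "ring_domain \<omega> a b = expE ` periodic_domain \<omega>"
proof
  show "ring_domain \<omega> a b \<subseteq> expE ` periodic_domain \<omega>"
  proof
    fix q assume "q \<in> ring_domain \<omega> a b"
    then obtain z where z: "z \<in> \<omega> \<union> J_plus a b \<union> J_minus a b" "q = expE z" by (auto simp: ring_domain_def)
    have "z - of_int 0 \<in> \<omega> \<union> J_minus a b \<or> z - of_int 1 \<in> \<omega> \<union> J_minus a b"
      using z(1) by (auto simp: J_plus_iff)
    thus "q \<in> expE ` periodic_domain \<omega>" using in_periodic_domainI z(2) by blast
  qed
  show "expE ` periodic_domain \<omega> \<subseteq> ring_domain \<omega> a b"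
  proof
    fix q assume "q \<in> expE ` periodic_domain \<omega>"
    then obtain z where z: "z \<in> periodic_domain \<omega>" "q = expE z" by auto
    have "expE (z - of_int \<lfloor>Re z\<rfloor>) \<in> ring_domain \<omega> a b"
      unfolding ring_domain_def using in_periodic_domainD[OF z(1)] by (intro imageI) auto
    thus "q \<in> ring_domain \<omega> a b" using z(2) expE_diff_int by simp
  qed
qed

lemma open_ring_domain: "open (ring_domain \<omega> a b)"
  unfolding ring_domain_eq
proof (rule open_mapping_thm[OF holomorphic_expE open_UNIV connected_UNIV open_periodic_domain])
  have "expE 0 \<noteq> expE \<i>"
    using norm_expE[of 0] norm_expE[of \<i>] by auto
  thus "\<not> expE constant_on UNIV" unfolding constant_on_def by (metis UNIV_I)
qed auto

end

section \<open>The conformal map onto a strip\<close>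

locale strip_setting = cell +
  fixes \<rho> \<delta> :: real and \<phi> :: "complex \<Rightarrow> complex" and \<theta> :: "complex \<Rightarrow> real"
  assumes rho: "1 < \<rho>"
    and conf: "annular_conformal_map (ring_domain \<omega> a b) \<rho> \<phi>"
    and delta: "0 < \<delta>"
    and cut: "\<forall>\<zeta> \<in> cut_curve \<phi> a b. \<delta> < Arg \<zeta> \<and> Arg \<zeta> < pi - \<delta>"
    and arg: "branch_arg \<omega> a b \<rho> \<phi> \<theta>"
begin

abbreviation "\<Omega> \<equiv> periodic_domain \<omega>"
abbreviation "\<Gamma> \<equiv> cut_curve \<phi> a b"
abbreviation "S_minus \<equiv> \<phi> ` expE ` cell_minus \<omega>"
abbreviation "S_plus \<equiv> \<phi> ` expE ` cell_plus \<omega>"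
abbreviation "S \<equiv> strip_map \<phi> \<theta>"

definition q :: "complex \<Rightarrow> complex" where "q z = \<phi> (expE z)"

lemma q_add_int: "q (z + of_int n) = q z" and q_diff_int: "q (z - of_int n) = q z"
  by (simp_all add: q_def expE_add_int expE_diff_int)

lemma q_add_1: "q (z + 1) = q z"
  using q_add_int[of z 1] by simp

lemma expE_ring: "z \<in> \<Omega> \<Longrightarrow> expE z \<in> ring_domain \<omega> a b"
  unfolding ring_domain_eq by simp

lemma phi_hol: "\<phi> holomorphic_on ring_domain \<omega> a b" and phi_inj: "inj_on \<phi> (ring_domain \<omega> a b)"
  and phi_img: "\<phi> ` ring_domain \<omega> a b = annulus \<rho>"
  using conf by (auto simp: annular_conformal_map_def)

lemma q_annulus: "z \<in> \<Omega> \<Longrightarrow> q z \<in> annulus \<rho>"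
  unfolding q_def phi_img[symmetric] using expE_ring by blast

lemma annulus_nz: "u \<in> annulus \<rho> \<Longrightarrow> u \<noteq> 0"
proof -
  have "0 < 1 / \<rho>" using rho by simp
  thus "u \<in> annulus \<rho> \<Longrightarrow> u \<noteq> 0" unfolding annulus_def by auto
qed

lemma q_nz: "z \<in> \<Omega> \<Longrightarrow> q z \<noteq> 0"
  using q_annulus annulus_nz by blast

lemma q_eq_iff: "z \<in> \<Omega> \<Longrightarrow> w \<in> \<Omega> \<Longrightarrow> q z = q w \<longleftrightarrow> (\<exists>n::int. z = w + of_int n)"
  unfolding q_def using inj_on_eq_iff[OF phi_inj expE_ring expE_ring] expE_eq_iff by blast

lemma q_deriv:
  assumes "z \<in> \<Omega>"
  shows "(q has_field_derivative (deriv \<phi> (expE z) * (\<i> * 2 * of_real pi * expE z))) (at z)"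
proof -
  have "(\<phi> has_field_derivative deriv \<phi> (expE z)) (at (expE z))"
    using phi_hol open_ring_domain expE_ring[OF assms] by (rule holomorphic_derivI)
  from DERIV_chain2[OF this expE_derivative] show ?thesis unfolding q_def .
qed

lemma q_hol: "q holomorphic_on \<Omega>"
  using q_deriv open_periodic_domain by (auto simp: holomorphic_on_open)

lemma q_isCont: "z \<in> \<Omega> \<Longrightarrow> isCont q z"
  using q_deriv DERIV_isCont by blast

lemma cell_in: "z \<in> \<omega> \<Longrightarrow> z \<in> \<Omega>" and J_minus_in: "z \<in> J_minus a b \<Longrightarrow> z \<in> \<Omega>"
  using in_periodic_domainI[of z 0] by auto

lemma add_int_in: "z \<in> \<Omega> \<Longrightarrow> z + of_int n \<in> \<Omega>"
  using in_periodic_domainD[of z] in_periodic_domainI[of "z + of_int n" "\<lfloor>Re z\<rfloor> + n"] by simp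

text \<open>Moves the study of the cut to \<open>Re z = 0\<close>, where the translates of cells
  used for the floor begin.\<close>

lemma cut_curve_eq: "\<Gamma> = q ` J_minus a b"
proof -
  have "J_plus a b = (\<lambda>z. z + 1) ` J_minus a b"
    unfolding set_eq_iff J_plus_iff by (auto simp: image_iff) (metis diff_add_cancel)
  thus ?thesis unfolding cut_curve_def by (simp add: image_image q_add_1 flip: q_def)
qed

lemma q_cell_not_cut:
  assumes "z \<in> \<omega>" shows "q z \<in> annulus \<rho> - \<Gamma>"
proof -
  have "q z \<notin> \<Gamma>"
  proof
    assume "q z \<in> \<Gamma>"
    then obtain j where j: "j \<in> J_minus a b" "q z = q j" unfolding cut_curve_eq by auto
    then obtain n :: int where "z = j + of_int n"
      using q_eq_iff[OF cell_in[OF assms] J_minus_in] by blast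
    hence "Re z = of_int n" using j by (simp add: J_minus_def)
    hence "0 < n \<and> n < 1" using cell_Re[OF assms] by simp
    thus False by linarith
  qed
  thus ?thesis using q_annulus[OF cell_in[OF assms]] by simp
qed

section \<open>The branch of the argument near the cut\<close>

lemma theta_cont: "continuous_on (annulus \<rho> - \<Gamma>) \<theta>"
  and theta_Arg: "u \<in> annulus \<rho> - \<Gamma> \<Longrightarrow> is_Arg u (\<theta> u) \<and> 0 \<le> \<theta> u \<and> \<theta> u \<le> 3 * pi"
  and theta_minus: "p \<in> \<Gamma> \<Longrightarrow> eventually (\<lambda>z. \<theta> z < pi) (at p within S_minus)"
  and theta_plus: "p \<in> \<Gamma> \<Longrightarrow> eventually (\<lambda>z. 2 * pi < \<theta> z) (at p within S_plus)"
  and theta_lim: "p \<in> \<Gamma> \<Longrightarrow> (\<theta> \<longlongrightarrow> \<theta> p) (at p within S_minus)"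
  using arg unfolding branch_arg_def Let_def by blast+

lemma is_Arg_unique_Arg:
  assumes "is_Arg u t" "u \<noteq> 0" "- pi < t" "t \<le> pi"
  shows "t = Arg u"
  using assms Arg_unique[of "norm u" t u] by (simp add: is_Arg_def)

lemma cut_Im_pos: "p \<in> \<Gamma> \<Longrightarrow> 0 < Im p"
  using cut delta Arg_lt_pi[of p] by force

text \<open>Since \<open>Arg\<close> stays away from \<open>0\<close> and \<open>\<pi>\<close> on the cut, the bounds on \<open>\<theta>\<close> from either side
  pin down its branch there. The left side of \<open>J_minus\<close> is reached through \<open>z + 1\<close>.\<close>

lemma near_cut:
  assumes j: "j \<in> J_minus a b"
  shows "\<exists>e>0. e < 1 / 2 \<and> (\<forall>z\<in>ball j e. z \<in> \<Omega> \<and> 0 < Im (q z) \<and>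
           (0 < Re z \<longrightarrow> z \<in> cell_minus \<omega> \<and> q z \<noteq> q j \<and> \<theta> (q z) = Arg (q z)) \<and>
           (Re z < 0 \<longrightarrow> \<theta> (q z) = Arg (q z) + 2 * pi) \<and>
           (Re z = 0 \<longrightarrow> z \<in> J_minus a b))"
proof -
  obtain e1 where e1: "0 < e1" "e1 < 1 / 2"
    "\<And>z. z \<in> ball j e1 \<Longrightarrow> 0 < Re z \<Longrightarrow> z \<in> cell_minus \<omega>"
    "\<And>z. z \<in> ball j e1 \<Longrightarrow> Re z < 0 \<Longrightarrow> z + 1 \<in> cell_plus \<omega>"
    "\<And>z. z \<in> ball j e1 \<Longrightarrow> Re z = 0 \<Longrightarrow> z \<in> J_minus a b"
    by (rule J_minus_nhd[OF j]) (rule that)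
  define p where "p = q j"
  have p: "p \<in> \<Gamma>" using j by (simp add: p_def cut_curve_eq)
  have jP: "j \<in> \<Omega>" by (rule J_minus_in[OF j])
  have j0: "Re j = 0" using j by (simp add: J_minus_def)
  obtain d1 where d1: "0 < d1" "\<And>u. u \<in> S_minus \<Longrightarrow> u \<noteq> p \<Longrightarrow> dist u p < d1 \<Longrightarrow> \<theta> u < pi"
    using theta_minus[OF p] unfolding eventually_at by blast
  obtain d2 where d2: "0 < d2" "\<And>u. u \<in> S_plus \<Longrightarrow> u \<noteq> p \<Longrightarrow> dist u p < d2 \<Longrightarrow> 2 * pi < \<theta> u"
    using theta_plus[OF p] unfolding eventually_at by blast
  \<comment> \<open>The bounds \<open>d1\<close> and \<open>d2\<close> make the one-sided estimates
    of \<open>\<theta>\<close> available; staying within distance \<open>Im p\<close> of p keeps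
    \<open>q z\<close> in the upper half-plane.\<close>
  have "0 < min (min d1 d2) (Im p)" using d1 d2 cut_Im_pos[OF p] by simp
  then obtain e2 where e2: "0 < e2" "\<And>z. dist z j < e2 \<Longrightarrow> dist (q z) p < min (min d1 d2) (Im p)"
    using q_isCont[OF jP] unfolding continuous_at_eps_delta p_def by blast
  define e where "e = min e1 e2"
  have "z \<in> \<Omega> \<and> 0 < Im (q z) \<and>
           (0 < Re z \<longrightarrow> z \<in> cell_minus \<omega> \<and> q z \<noteq> q j \<and> \<theta> (q z) = Arg (q z)) \<and>
           (Re z < 0 \<longrightarrow> \<theta> (q z) = Arg (q z) + 2 * pi) \<and>
           (Re z = 0 \<longrightarrow> z \<in> J_minus a b)" if z: "z \<in> ball j e" for z
  proof -
    have z1: "z \<in> ball j e1" using z by (simp add: e_def)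
    have dist: "dist (q z) p < d1" "dist (q z) p < d2" "dist (q z) p < Im p"
      using e2(2)[of z] z by (auto simp: e_def dist_commute)
    have Rz: "\<bar>Re z\<bar> < 1 / 2"
      using z1 e1(2) j0 abs_Re_le_cmod[of "z - j"] by (simp add: dist_norm norm_minus_commute)
    have zP: "z \<in> \<Omega>"
    proof (cases "Re z" "0::real" rule: linorder_cases)
      case less
      hence "z + 1 \<in> \<Omega>" using e1(4)[OF z1] cell_in by (auto simp: cell_plus_def)
      from add_int_in[OF this, of "-1"] show ?thesis by simp
    next
      case equal
      thus ?thesis using e1(5)[OF z1] J_minus_in by blast
    next
      case greater
      thus ?thesis using e1(3)[OF z1] cell_in by (auto simp: cell_minus_def)
    qed
    have Im: "0 < Im (q z)"
      using dist(3) abs_Im_le_cmod[of "q z - p"] by (simp add: dist_norm)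
    \<comment> \<open>The estimates of \<open>\<theta>\<close> are filters at p and say nothing at p
      itself, so this value must be avoided.\<close>
    have ne: "q z \<noteq> p" if "Re z \<noteq> 0"
    proof
      assume "q z = p"
      then obtain n :: int where "z = j + of_int n"
        unfolding p_def using q_eq_iff[OF zP jP] by blast
      hence "Re z = of_int n" using j0 by simp
      with Rz that show False by auto
    qed
    have minus: "z \<in> cell_minus \<omega> \<and> q z \<noteq> q j \<and> \<theta> (q z) = Arg (q z)" if "0 < Re z"
    proof -
      have zc: "z \<in> cell_minus \<omega>" using e1(3)[OF z1 that] .
      hence "\<theta> (q z) < pi" using d1(2)[of "q z"] dist ne that by (auto simp: q_def)
      moreover have "is_Arg (q z) (\<theta> (q z))" "0 \<le> \<theta> (q z)"
        using theta_Arg[OF q_cell_not_cut] zc by (auto simp: cell_minus_def)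
      ultimately have "\<theta> (q z) = Arg (q z)"
        using q_nz[OF zP] pi_gt_zero by (intro is_Arg_unique_Arg) linarith+
      thus ?thesis using zc ne that by (simp add: p_def)
    qed
    have plus: "\<theta> (q z) = Arg (q z) + 2 * pi" if "Re z < 0"
    proof -
      have zc: "z + 1 \<in> cell_plus \<omega>" using e1(4)[OF z1 that] .
      hence "q (z + 1) \<in> S_plus" by (auto simp: q_def)
      hence "2 * pi < \<theta> (q z)" using d2(2)[of "q z"] dist ne that by (simp add: q_add_1)
      moreover have "is_Arg (q (z + 1)) (\<theta> (q (z + 1))) \<and> \<theta> (q (z + 1)) \<le> 3 * pi"
        using theta_Arg[OF q_cell_not_cut] zc by (auto simp: cell_plus_def)
      hence A: "is_Arg (q z) (\<theta> (q z))" "\<theta> (q z) \<le> 3 * pi"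
        unfolding q_add_1 by auto
      moreover have "is_Arg (q z) (\<theta> (q z) - 2 * pi)"
        using A(1) by (simp add: is_Arg_def exp_diff right_diff_distrib mult_ac)
      ultimately have "\<theta> (q z) - 2 * pi = Arg (q z)"
        using q_nz[OF zP] pi_gt_zero by (intro is_Arg_unique_Arg) linarith+
      thus ?thesis by simp
    qed
    show ?thesis using zP Im minus plus e1(5)[OF z1] by blast
  qed
  moreover have "0 < e" "e < 1 / 2" using e1 e2 by (auto simp: e_def)
  ultimately show ?thesis by blast
qed

text \<open>On the cut \<open>\<theta>\<close> is by convention the limit from the side of
  \<open>cell_minus\<close>, where it agrees with \<open>Arg\<close>; the latter is continuous in
  the upper half-plane.\<close>

lemma theta_cut:
  assumes j: "j \<in> J_minus a b"
  shows "\<theta> (q j) = Arg (q j)"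
proof -
  obtain e where e: "0 < e" "\<And>z. z \<in> ball j e \<Longrightarrow> 0 < Re z \<Longrightarrow> z \<in> cell_minus \<omega> \<and> q z \<noteq> q j \<and> \<theta> (q z) = Arg (q z)"
    using near_cut[OF j] by blast
  have p: "q j \<in> \<Gamma>" using j by (simp add: cut_curve_eq)
  \<comment> \<open>Approaches j horizontally from the right; the shift by 2 puts even the term n =
    0 strictly inside the ball.\<close>
  define X where "X = (\<lambda>n. j + of_real (e / real (n + 2)))"
  have X: "X n \<in> cell_minus \<omega> \<and> q (X n) \<noteq> q j \<and> \<theta> (q (X n)) = Arg (q (X n))" for n
  proof (rule e(2))
    have "e * 1 < e * real (n + 2)" using e(1) by (intro mult_strict_left_mono) auto
    hence "e / real (n + 2) < e" by (subst pos_divide_less_eq) auto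
    thus "X n \<in> ball j e" using e(1) unfolding X_def by (simp add: dist_norm del: of_real_divide)
    show "0 < Re (X n)" using e(1) j unfolding X_def by (simp add: J_minus_def del: of_real_divide)
  qed
  have "(\<lambda>n. e / real (n + 2)) \<longlonglongrightarrow> 0" by (rule LIMSEQ_ignore_initial_segment[OF lim_const_over_n])
  hence "X \<longlonglongrightarrow> j + of_real 0" unfolding X_def by (intro tendsto_intros)
  hence qX: "(\<lambda>n. q (X n)) \<longlonglongrightarrow> q j"
    using isCont_tendsto_compose[OF q_isCont[OF J_minus_in[OF j]], of X] by simp
  have "filterlim (\<lambda>n. q (X n)) (at (q j) within S_minus) sequentially"
    unfolding filterlim_at using qX X by (auto simp: q_def)
  hence "(\<lambda>n. \<theta> (q (X n))) \<longlonglongrightarrow> \<theta> (q j)"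
    using theta_lim[OF p] filterlim_compose by blast
  moreover have "(\<lambda>n. \<theta> (q (X n))) \<longlonglongrightarrow> Arg (q j)"
  proof -
    have "isCont Arg (q j)"
      using cut_Im_pos[OF p] by (intro continuous_at_Arg) (auto simp: complex_nonpos_Reals_iff)
    from isCont_tendsto_compose[OF this qX] show ?thesis using X by simp
  qed
  ultimately show ?thesis by (rule LIMSEQ_unique)
qed

section \<open>The strip map is conformal onto its image\<close>

lemma strip_map_add_int: "S (z + of_int n) = S z + of_int n"
  by (simp add: strip_map_def expE_add_int)

lemma strip_map_altdef:
  "S z = 1 / (\<i> * 2 * of_real pi) * (of_real (ln (norm (q z))) + \<i> * of_real (\<theta> (q z))) + of_int \<lfloor>Re z\<rfloor>"
  by (simp add: strip_map_def branch_log_def q_def)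

lemma is_Arg_theta:
  assumes "z \<in> \<Omega>"
  shows "is_Arg (q z) (\<theta> (q z))"
proof -
  define z' where "z' = z - of_int \<lfloor>Re z\<rfloor>"
  have "z' \<in> \<omega> \<or> z' \<in> J_minus a b" using in_periodic_domainD[OF assms] by (auto simp: z'_def)
  hence "is_Arg (q z') (\<theta> (q z'))"
  proof
    assume "z' \<in> \<omega>"
    thus ?thesis using theta_Arg[OF q_cell_not_cut] by blast
  next
    assume j: "z' \<in> J_minus a b"
    show ?thesis unfolding theta_cut[OF j] using q_nz[OF J_minus_in[OF j]] by (rule is_Arg_Arg)
  qed
  thus ?thesis by (simp add: z'_def q_diff_int)
qed

lemma exp_strip_map:
  assumes "z \<in> \<Omega>"
  shows "exp (\<i> * 2 * of_real pi * S z) = q z"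
proof -
  have "\<i> * 2 * of_real pi * S z = of_real (ln (norm (q z))) + \<i> * of_real (\<theta> (q z)) +
      of_real (of_int (2 * \<lfloor>Re z\<rfloor>) * pi) * \<i>"
    unfolding strip_map_altdef by (simp add: field_simps)
  moreover have "exp (\<dots>) = exp (of_real (ln (norm (q z))) + \<i> * of_real (\<theta> (q z)))"
    unfolding exp_eq by blast
  ultimately have "exp (\<i> * 2 * of_real pi * S z) = exp (of_real (ln (norm (q z)))) * exp (\<i> * of_real (\<theta> (q z)))"
    by (simp add: exp_add)
  also have "exp (complex_of_real (ln (norm (q z)))) = of_real (norm (q z))"
    using q_nz[OF assms] by (simp add: exp_of_real)
  finally show ?thesis using is_Arg_theta[OF assms] by (simp add: is_Arg_def)
qed

text \<open>Left of the seam the argument exceeds \<open>Arg\<close> by 2 pi, which adds 1 after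
  division by 2 pi, while the floor is -1. The two corrections cancel, so the principal logarithm
  describes both sides at once.\<close>

lemma strip_map_near_cut:
  assumes j: "j \<in> J_minus a b"
  shows "\<exists>e>0. \<forall>z\<in>ball j e. z \<in> \<Omega> \<and> 0 < Im (q z) \<and> S z = 1 / (\<i> * 2 * of_real pi) * Ln (q z)"
proof -
  obtain e where e: "0 < e" "e < 1 / 2" and *: "\<And>z. z \<in> ball j e \<Longrightarrow> z \<in> \<Omega> \<and> 0 < Im (q z) \<and>
           (0 < Re z \<longrightarrow> z \<in> cell_minus \<omega> \<and> q z \<noteq> q j \<and> \<theta> (q z) = Arg (q z)) \<and>
           (Re z < 0 \<longrightarrow> \<theta> (q z) = Arg (q z) + 2 * pi) \<and>
           (Re z = 0 \<longrightarrow> z \<in> J_minus a b)"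
    using near_cut[OF j] by blast
  have "S z = 1 / (\<i> * 2 * of_real pi) * Ln (q z)" if z: "z \<in> ball j e" for z
  proof -
    have Rz: "\<bar>Re z\<bar> < 1 / 2"
      using z e(2) j abs_Re_le_cmod[of "z - j"] by (simp add: dist_norm norm_minus_commute J_minus_def)
    have Ln: "Ln (q z) = of_real (ln (norm (q z))) + \<i> * of_real (Arg (q z))"
      using *[OF z] q_nz by (intro Ln_Arg) blast
    show ?thesis
    proof (cases "Re z < 0")
      case True
      hence "\<lfloor>Re z\<rfloor> = -1" using Rz by (intro floor_unique) auto
      moreover have "\<theta> (q z) = Arg (q z) + 2 * pi" using *[OF z] True by blast
      ultimately show ?thesis unfolding strip_map_altdef Ln by (simp add: field_simps)
    next
      case False
      hence "\<lfloor>Re z\<rfloor> = 0" using Rz by (intro floor_unique) auto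
      moreover have "\<theta> (q z) = Arg (q z)"
        using *[OF z] False theta_cut[of z] by (cases "Re z = 0") auto
      ultimately show ?thesis unfolding strip_map_altdef Ln by simp
    qed
  qed
  thus ?thesis using e * by blast
qed

text \<open>Translation by the floor reduces to a point of \<open>\<omega>\<close>, where
  \<open>q\<close> avoids the cut and \<open>\<theta>\<close> is continuous, or of
  \<open>J_minus\<close>, where the principal logarithm is used.\<close>

lemma strip_map_isCont:
  assumes z: "z \<in> \<Omega>"
  shows "isCont S z"
proof -
  define m where "m = \<lfloor>Re z\<rfloor>"
  define z' where "z' = z - of_int m"
  have "z' \<in> \<omega> \<or> z' \<in> J_minus a b" using in_periodic_domainD[OF z] by (auto simp: z'_def m_def)
  hence "isCont S z'"
  proof
    assume w: "z' \<in> \<omega>"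
    have "continuous_on \<omega> (\<lambda>z. 1 / (\<i> * 2 * of_real pi) * (of_real (ln (norm (q z))) + \<i> * of_real (\<theta> (q z))))"
    proof -
      have "continuous_on \<omega> q"
        using q_isCont cell_in by (auto intro!: continuous_at_imp_continuous_on)
      moreover have "norm (q z) \<noteq> 0" if "z \<in> \<omega>" for z using q_nz[OF cell_in[OF that]] by simp
      ultimately show ?thesis
        using q_cell_not_cut
        by (intro continuous_intros continuous_on_compose2[OF theta_cont]) auto
    qed
    hence "continuous_on \<omega> S"
    proof (rule continuous_on_eq)
      fix z assume "z \<in> \<omega>"
      hence "\<lfloor>Re z\<rfloor> = 0" using cell_Re[of z] by (intro floor_unique) auto
      thus "1 / (\<i> * 2 * of_real pi) * (of_real (ln (norm (q z))) + \<i> * of_real (\<theta> (q z))) = S z"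
        by (simp add: strip_map_altdef)
    qed
    thus ?thesis using w open_cell continuous_on_eq_continuous_at by blast
  next
    assume j: "z' \<in> J_minus a b"
    obtain e where e: "0 < e" "\<And>z. z \<in> ball z' e \<Longrightarrow> z \<in> \<Omega> \<and> 0 < Im (q z) \<and> S z = 1 / (\<i> * 2 * of_real pi) * Ln (q z)"
      using strip_map_near_cut[OF j] by blast
    have "continuous_on (ball z' e) q"
      using q_isCont e by (auto intro!: continuous_at_imp_continuous_on)
    moreover have "q z \<notin> \<real>\<^sub>\<le>\<^sub>0" if "z \<in> ball z' e" for z
      using e(2)[OF that] by (auto simp: complex_nonpos_Reals_iff)
    ultimately have "continuous_on (ball z' e) (\<lambda>z. 1 / (\<i> * 2 * of_real pi) * Ln (q z))"
      by (intro continuous_intros) auto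
    hence "continuous_on (ball z' e) S"
      by (rule continuous_on_eq) (use e(2) in auto)
    thus ?thesis using e(1) continuous_on_eq_continuous_at[OF open_ball] centre_in_ball by blast
  qed
  hence "isCont (\<lambda>u. S (u - of_int m) + of_int m) z"
    unfolding z'_def by (intro continuous_intros isCont_o2[of _ "\<lambda>u. u - of_int m" S]) auto
  moreover have "(\<lambda>u. S (u - of_int m) + of_int m) = S"
    by (simp flip: strip_map_add_int)
  ultimately show ?thesis by simp
qed

lemma strip_map_hol: "S holomorphic_on \<Omega>"
proof -
  let ?s = "\<lambda>z. \<i> * 2 * of_real pi * S z"
  have "?s holomorphic_on \<Omega>"
  proof (rule continuous_exp_holomorphic[OF open_periodic_domain])
    show "continuous_on \<Omega> ?s"
      using strip_map_isCont by (intro continuous_intros continuous_at_imp_continuous_on) auto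
    show "(\<lambda>z. exp (?s z)) holomorphic_on \<Omega>"
      using q_hol by (rule holomorphic_transform) (simp add: exp_strip_map)
  qed
  hence "(\<lambda>z. 1 / (\<i> * 2 * of_real pi) * ?s z) holomorphic_on \<Omega>"
    by (rule holomorphic_on_mult[OF holomorphic_on_const])
  thus ?thesis by (rule holomorphic_transform) simp
qed

text \<open>Differentiate exp (2 pi i S) = \<phi> (expE z) and cancel 2 pi i. The resulting
  exponential is the origin of the one in \<open>K_tilde\<close>.\<close>

lemma deriv_strip_map:
  assumes z: "z \<in> \<Omega>"
  shows "deriv S z = exp (\<i> * 2 * of_real pi * (z - S z)) * deriv \<phi> (expE z)"
proof -
  let ?c = "\<i> * 2 * of_real pi"
  have "(S has_field_derivative deriv S z) (at z)"
    by (rule holomorphic_derivI[OF strip_map_hol open_periodic_domain z])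
  hence "((\<lambda>u. exp (?c * S u)) has_field_derivative exp (?c * S z) * (?c * deriv S z)) (at z)"
    by (auto intro!: derivative_eq_intros)
  hence "(q has_field_derivative exp (?c * S z) * (?c * deriv S z)) (at z)"
    by (rule has_field_derivative_transform_within_open[OF _ open_periodic_domain z]) (rule exp_strip_map)
  from DERIV_unique[OF this q_deriv[OF z]]
  have "?c * (exp (?c * S z) * deriv S z) = ?c * (deriv \<phi> (expE z) * expE z)" by (simp add: mult_ac)
  hence "exp (?c * S z) * deriv S z = deriv \<phi> (expE z) * expE z"
    by (subst (asm) mult_left_cancel) auto
  hence "deriv S z = deriv \<phi> (expE z) * (exp (?c * z) / exp (?c * S z))"
    by (simp add: expE_def field_simps)
  thus ?thesis by (simp add: exp_diff[symmetric] right_diff_distrib mult_ac)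
qed

text \<open>Equal values give equal \<open>q\<close>, hence points that differ by an integer; the
  strip map moves by that same integer, which must be 0.\<close>

lemma strip_map_inj: "inj_on S \<Omega>"
proof (rule inj_onI)
  fix z w assume z: "z \<in> \<Omega>" and w: "w \<in> \<Omega>" and eq: "S z = S w"
  hence "q z = q w" using exp_strip_map by metis
  then obtain n :: int where n: "z = w + of_int n" using q_eq_iff[OF z w] by blast
  with eq have "of_int n = (0::complex)" by (simp add: strip_map_add_int)
  thus "z = w" using n by simp
qed

text \<open>Since |q| = exp (- 2 pi Im S), the annulus bounds become bounds on the imaginary part.
  Conversely a preimage under \<open>q\<close> hits the target up to an integer, which a translation
  in the domain repairs.\<close>

lemma strip_map_image: "S ` \<Omega> = {\<zeta>. \<bar>Im \<zeta>\<bar> < ln \<rho> / (2 * pi)}"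
proof (intro set_eqI iffI)
  fix \<zeta> assume "\<zeta> \<in> S ` \<Omega>"
  then obtain z where z: "z \<in> \<Omega>" "\<zeta> = S z" by blast
  have "exp (- 2 * pi * Im \<zeta>) = norm (q z)"
    using exp_strip_map[OF z(1), symmetric] z(2) by simp
  hence "1 / \<rho> < exp (- 2 * pi * Im \<zeta>)" "exp (- 2 * pi * Im \<zeta>) < \<rho>"
    using q_annulus[OF z(1)] by (auto simp: annulus_def)
  moreover have "1 / \<rho> = exp (- ln \<rho>)" "\<rho> = exp (ln \<rho>)" using rho by (simp_all add: exp_minus field_simps)
  ultimately have "- ln \<rho> < - 2 * pi * Im \<zeta>" "- 2 * pi * Im \<zeta> < ln \<rho>"
    by (metis exp_less_cancel_iff)+
  thus "\<zeta> \<in> {\<zeta>. \<bar>Im \<zeta>\<bar> < ln \<rho> / (2 * pi)}"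
    by (simp add: pos_less_divide_eq abs_less_iff mult_ac)
next
  fix \<zeta> :: complex assume "\<zeta> \<in> {\<zeta>. \<bar>Im \<zeta>\<bar> < ln \<rho> / (2 * pi)}"
  hence "- ln \<rho> < - 2 * pi * Im \<zeta>" "- 2 * pi * Im \<zeta> < ln \<rho>"
    by (simp_all add: pos_less_divide_eq abs_less_iff mult_ac)
  moreover have "1 / \<rho> = exp (- ln \<rho>)" "\<rho> = exp (ln \<rho>)" using rho by (simp_all add: exp_minus field_simps)
  ultimately have "1 / \<rho> < norm (expE \<zeta>)" "norm (expE \<zeta>) < \<rho>"
    unfolding norm_expE by (metis exp_less_cancel_iff)+
  hence "expE \<zeta> \<in> annulus \<rho>" by (simp add: annulus_def)
  then obtain z where z: "z \<in> \<Omega>" "expE \<zeta> = q z"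
    unfolding phi_img[symmetric] ring_domain_eq q_def by auto
  hence "expE \<zeta> = expE (S z)" using exp_strip_map[OF z(1)] by (simp add: expE_def)
  then obtain n :: int where "\<zeta> = S z + of_int n" unfolding expE_eq_iff by blast
  hence "\<zeta> = S (z + of_int n)" by (simp add: strip_map_add_int)
  thus "\<zeta> \<in> S ` \<Omega>" using add_int_in[OF z(1)] by blast
qed

end

section \<open>From the strip to the disc\<close>

text \<open>This is \<open>tanh (c \<zeta>)\<close>.\<close>

definition strip_to_disc :: "real \<Rightarrow> complex \<Rightarrow> complex" where
  "strip_to_disc c \<zeta> = (exp (2 * of_real c * \<zeta>) - 1) / (exp (2 * of_real c * \<zeta>) + 1)"

text \<open>The half-width is where 2 c zeta reaches imaginary part pi / 2, so that exp (2 c zeta)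
  fills the right half-plane.\<close>

definition horizontal_strip :: "real \<Rightarrow> complex set" where
  "horizontal_strip c = {\<zeta>. \<bar>Im \<zeta>\<bar> < pi / (4 * c)}"

text \<open>The Cayley transform: the right half-plane consists of the points closer to 1 than to
  -1.\<close>

lemma cayley_disc:
  assumes "u + 1 \<noteq> 0"
  shows "norm ((u - 1) / (u + 1)) < 1 \<longleftrightarrow> 0 < Re u"
proof -
  have "norm ((u - 1) / (u + 1)) < 1 \<longleftrightarrow> norm (u - 1) < norm (u + 1)"
    using assms by (simp add: norm_divide)
  also have "\<dots> \<longleftrightarrow> (norm (u - 1))\<^sup>2 < (norm (u + 1))\<^sup>2"
    by (metis norm_ge_zero power2_less_imp_less power_strict_mono zero_less_numeral)
  also have "\<dots> \<longleftrightarrow> 0 < Re u"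
    unfolding cmod_power2 by (simp add: power2_eq_square algebra_simps)
  finally show ?thesis .
qed

context
  fixes c :: real
  assumes c: "0 < c"
begin

lemma open_horizontal_strip: "open (horizontal_strip c)"
  unfolding horizontal_strip_def by (intro open_Collect_less continuous_intros)

lemma strip_exp_Re:
  assumes "\<zeta> \<in> horizontal_strip c"
  shows "0 < Re (exp (2 * of_real c * \<zeta>))"
proof -
  have "4 * c * \<bar>Im \<zeta>\<bar> < pi"
    using assms c by (simp add: horizontal_strip_def field_simps)
  hence "\<bar>2 * c * Im \<zeta>\<bar> < pi / 2"
    using c by (simp add: abs_mult)
  hence "0 < cos (2 * c * Im \<zeta>)" by (intro cos_gt_zero_pi) linarith+
  thus ?thesis unfolding Re_exp by simp
qed

lemma strip_exp_plus_one: "\<zeta> \<in> horizontal_strip c \<Longrightarrow> exp (2 * of_real c * \<zeta>) + 1 \<noteq> 0"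
  using strip_exp_Re[of \<zeta>] by (auto simp: complex_eq_iff)

lemma strip_to_disc_derivative:
  assumes "\<zeta> \<in> horizontal_strip c"
  shows "(strip_to_disc c has_field_derivative
           4 * of_real c * exp (2 * of_real c * \<zeta>) / (exp (2 * of_real c * \<zeta>) + 1)\<^sup>2) (at \<zeta>)"
  unfolding strip_to_disc_def
  by (rule derivative_eq_intros refl strip_exp_plus_one[OF assms])+
     (simp add: power2_eq_square algebra_simps)

lemma strip_to_disc_hol: "strip_to_disc c holomorphic_on (horizontal_strip c)"
  using strip_to_disc_derivative open_horizontal_strip by (auto simp: holomorphic_on_open)

lemma strip_to_disc_inj: "inj_on (strip_to_disc c) (horizontal_strip c)"
proof (rule inj_onI)
  fix z w assume z: "z \<in> horizontal_strip c" and w: "w \<in> horizontal_strip c" and eq: "strip_to_disc c z = strip_to_disc c w"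
  have e: "exp (2 * of_real c * z) = exp (2 * of_real c * w)"
    using eq strip_exp_plus_one[OF z] strip_exp_plus_one[OF w]
    by (simp add: strip_to_disc_def field_simps)
  have b: "\<bar>Im (2 * of_real c * z) - Im (2 * of_real c * w)\<bar> < 2 * pi"
  proof -
    have "\<bar>Im z\<bar> < pi / (4 * c)" "\<bar>Im w\<bar> < pi / (4 * c)" using z w by (auto simp: horizontal_strip_def)
    hence "\<bar>Im z - Im w\<bar> < pi / (2 * c)" by (simp add: abs_less_iff)
    hence "2 * c * \<bar>Im z - Im w\<bar> < pi" using c by (simp add: field_simps)
    hence "\<bar>2 * c * Im z - 2 * c * Im w\<bar> < pi"
      using c by (simp add: abs_mult flip: right_diff_distrib)
    thus ?thesis using pi_gt_zero by simp
  qed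
  have "2 * of_real c * z = 2 * of_real c * w" by (rule exp_complex_eqI[OF b e])
  thus "z = w" using c by simp
qed

lemma strip_to_disc_image: "strip_to_disc c ` horizontal_strip c = ball 0 1"
proof (intro set_eqI iffI)
  fix v assume "v \<in> strip_to_disc c ` horizontal_strip c"
  then obtain z where "z \<in> horizontal_strip c" "v = strip_to_disc c z" by blast
  thus "v \<in> ball 0 1"
    using cayley_disc[OF strip_exp_plus_one, of z] strip_exp_Re[of z] by (simp add: strip_to_disc_def)
next
  fix v :: complex assume v: "v \<in> ball 0 1"
  \<comment> \<open>The inverse Cayley transform of \<open>v\<close>.\<close>
  define u where "u = (1 + v) / (1 - v)"
  have v1: "1 - v \<noteq> 0" using v by auto
  have "u + 1 = 2 / (1 - v)" using v1 by (simp add: u_def field_simps)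
  moreover have "u - 1 = 2 * v / (1 - v)" using v1 by (simp add: u_def field_simps)
  ultimately have uv: "u + 1 \<noteq> 0" "(u - 1) / (u + 1) = v" using v1 by auto
  hence u: "0 < Re u" using cayley_disc[of u] v by simp
  define z where "z = Ln u / (2 * of_real c)"
  have "u \<noteq> 0" using u by auto
  moreover have cz: "2 * of_real c * z = Ln u" using c by (simp add: z_def)
  ultimately have e: "exp (2 * of_real c * z) = u" by simp
  have "\<bar>Im (Ln u)\<bar> < pi / 2" using u Re_Ln_pos_lt[OF \<open>u \<noteq> 0\<close>] by simp
  moreover have "Im (Ln u) = 2 * c * Im z" using arg_cong[OF cz, of Im] by simp
  ultimately have "z \<in> horizontal_strip c" using c by (simp add: horizontal_strip_def abs_mult field_simps)
  moreover have "strip_to_disc c z = v" using e uv by (simp add: strip_to_disc_def)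
  ultimately show "v \<in> strip_to_disc c ` horizontal_strip c" by blast
qed

text \<open>With A = c z and B = c cnj w, the derivatives contribute c / cosh^2 A and c / cosh^2 B,
  and 1 - tanh A tanh B = cosh (A - B) / (cosh A cosh B) by the addition theorem; all but cosh (A -
  B) cancels. The proof writes this rationally in u = exp A and v = exp B.\<close>

lemma strip_kernel_eq:
  assumes z: "z \<in> horizontal_strip c" and w: "w \<in> horizontal_strip c"
  shows "deriv (strip_to_disc c) z * cnj (deriv (strip_to_disc c) w) * disc_kernel (strip_to_disc c z) (strip_to_disc c w)
    = of_real (c\<^sup>2 / pi) * (sech (of_real c * (z - cnj w)))\<^sup>2"
proof -
  define u where "u = exp (of_real c * z)"
  define v where "v = exp (of_real c * cnj w)"
  have uv0: "u \<noteq> 0" "v \<noteq> 0" by (simp_all add: u_def v_def)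
  have eu: "exp (2 * of_real c * z) = u\<^sup>2"
    by (simp add: u_def exp_double[symmetric] mult_ac)
  have ew: "cnj (exp (2 * of_real c * w)) = v\<^sup>2"
    by (simp add: v_def exp_cnj exp_double[symmetric] mult_ac)
  have nu: "u\<^sup>2 + 1 \<noteq> 0" using strip_exp_plus_one[OF z] eu by simp
  have nv: "v\<^sup>2 + 1 \<noteq> 0" using strip_exp_plus_one[OF w] ew by (metis complex_cnj_add complex_cnj_one complex_cnj_zero_iff)
  have d1: "deriv (strip_to_disc c) z = 4 * of_real c * u\<^sup>2 / (u\<^sup>2 + 1)\<^sup>2"
    using DERIV_imp_deriv[OF strip_to_disc_derivative[OF z]] by (simp add: eu)
  have "cnj (deriv (strip_to_disc c) w) = 4 * of_real c * cnj (exp (2 * of_real c * w)) / (cnj (exp (2 * of_real c * w)) + 1)\<^sup>2"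
    unfolding DERIV_imp_deriv[OF strip_to_disc_derivative[OF w]] by simp
  hence d2: "cnj (deriv (strip_to_disc c) w) = 4 * of_real c * v\<^sup>2 / (v\<^sup>2 + 1)\<^sup>2"
    unfolding ew .
  have t1: "strip_to_disc c z = (u\<^sup>2 - 1) / (u\<^sup>2 + 1)" by (simp add: strip_to_disc_def eu)
  have "cnj (strip_to_disc c w) = (cnj (exp (2 * of_real c * w)) - 1) / (cnj (exp (2 * of_real c * w)) + 1)"
    unfolding strip_to_disc_def by simp
  hence t2: "cnj (strip_to_disc c w) = (v\<^sup>2 - 1) / (v\<^sup>2 + 1)" unfolding ew .
  have one: "1 - strip_to_disc c z * cnj (strip_to_disc c w) = 2 * (u\<^sup>2 + v\<^sup>2) / ((u\<^sup>2 + 1) * (v\<^sup>2 + 1))"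
  proof -
    have frac: "1 - P / X * (Q / Y) = (X * Y - P * Q) / (X * Y)" if "X \<noteq> 0" "Y \<noteq> 0" for P Q X Y :: complex
      using that by (simp add: field_simps)
    have "1 - (u\<^sup>2 - 1) / (u\<^sup>2 + 1) * ((v\<^sup>2 - 1) / (v\<^sup>2 + 1)) =
        ((u\<^sup>2 + 1) * (v\<^sup>2 + 1) - (u\<^sup>2 - 1) * (v\<^sup>2 - 1)) / ((u\<^sup>2 + 1) * (v\<^sup>2 + 1))"
      by (rule frac[OF nu nv])
    also have "(u\<^sup>2 + 1) * (v\<^sup>2 + 1) - (u\<^sup>2 - 1) * (v\<^sup>2 - 1) = 2 * (u\<^sup>2 + v\<^sup>2)"
      by (simp add: algebra_simps)
    finally show ?thesis unfolding t1 t2 .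
  qed
  \<comment> \<open>Both images lie in the unit disc, so the kernel's denominator is non-zero; this
    is what excludes \<open>u\<^sup>2 + v\<^sup>2 = 0\<close>.\<close>
  have "norm (strip_to_disc c z * cnj (strip_to_disc c w)) < 1"
  proof -
    have "norm (strip_to_disc c z) < 1" "norm (strip_to_disc c w) < 1"
      using z w strip_to_disc_image by auto
    thus ?thesis using mult_strict_mono'[of "norm (strip_to_disc c z)" 1 "norm (strip_to_disc c w)" 1]
      by (simp add: norm_mult)
  qed
  hence "1 - strip_to_disc c z * cnj (strip_to_disc c w) \<noteq> 0" by auto
  hence ne: "u\<^sup>2 + v\<^sup>2 \<noteq> 0" unfolding one by (metis divide_eq_0_iff mult_eq_0_iff)
  have ex: "exp (of_real c * (z - cnj w)) = u / v" "exp (- (of_real c * (z - cnj w))) = v / u"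
    by (simp_all add: u_def v_def exp_diff[symmetric] right_diff_distrib)
  have "u / v + v / u = (u\<^sup>2 + v\<^sup>2) / (u * v)"
    using uv0 by (simp add: field_simps power2_eq_square)
  hence s: "sech (of_real c * (z - cnj w)) = 2 * u * v / (u\<^sup>2 + v\<^sup>2)"
    unfolding sech_def ex by simp
  \<comment> \<open>Hiding the three sums behind names leaves a cancellation of monomials.\<close>
  define A where "A = u\<^sup>2 + 1"
  define B where "B = v\<^sup>2 + 1"
  define C where "C = u\<^sup>2 + v\<^sup>2"
  have "A \<noteq> 0" "B \<noteq> 0" "C \<noteq> 0" using nu nv ne by (auto simp: A_def B_def C_def)
  hence "4 * of_real c * u\<^sup>2 / A\<^sup>2 * (4 * of_real c * v\<^sup>2 / B\<^sup>2) * (1 / (of_real pi * (2 * C / (A * B))\<^sup>2))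
     = (of_real c)\<^sup>2 / of_real pi * (2 * u * v / C)\<^sup>2"
    by (simp add: power_divide power_mult_distrib) (simp add: power2_eq_square)
  thus ?thesis
    unfolding d1 d2 disc_kernel_def one s A_def[symmetric] B_def[symmetric] C_def[symmetric] by simp
qed

lemma is_bergman_kernel_strip:
  "is_bergman_kernel (horizontal_strip c) (\<lambda>z w. deriv (strip_to_disc c) z * cnj (deriv (strip_to_disc c) w)
       * disc_kernel (strip_to_disc c z) (strip_to_disc c w))"
  by (rule is_bergman_kernel_conformal[OF open_horizontal_strip strip_to_disc_hol strip_to_disc_inj])
     (simp add: strip_to_disc_image is_bergman_kernel_disc)

end

theorem proposition2p3:
  fixes \<omega> :: "complex set" and M a b \<rho> \<delta> :: real
    and \<phi> :: "complex \<Rightarrow> complex" and \<theta> :: "complex \<Rightarrow> real" and z w :: complex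
  assumes "periodic_cell \<omega> M a b"
    and "simply_connected (periodic_domain \<omega>)"
    and "1 < \<rho>"
    and "annular_conformal_map (ring_domain \<omega> a b) \<rho> \<phi>"
    and "0 < \<delta>" and "\<delta> < 1"
    and "\<forall>\<zeta> \<in> cut_curve \<phi> a b. \<delta> < Arg \<zeta> \<and> Arg \<zeta> < pi - \<delta>"
    and "branch_arg \<omega> a b \<rho> \<phi> \<theta>"
    and "z \<in> periodic_domain \<omega>" and "w \<in> periodic_domain \<omega>"
  shows "bergman_kernel (periodic_domain \<omega>) z w =
           K_tilde \<phi> \<theta> z w * of_real (pi ^ 3 / (4 * (ln \<rho>)\<^sup>2))
           * (sech (of_real (pi\<^sup>2) * (strip_map \<phi> \<theta> z - cnj (strip_map \<phi> \<theta> w))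
                    / of_real (2 * ln \<rho>)))\<^sup>2"
proof -
  interpret strip_setting \<omega> M a b \<rho> \<delta> \<phi> \<theta>
    using assms by unfold_locales
  \<comment> \<open>Solves pi / (4 c) = ln \<rho> / (2 pi), the equality of the two
    half-widths.\<close>
  define c where "c = pi\<^sup>2 / (2 * ln \<rho>)"
  have ln: "0 < ln \<rho>" using assms(3) by simp
  have c: "0 < c" unfolding c_def using ln by simp
  have "pi / (4 * c) = ln \<rho> / (2 * pi)"
    unfolding c_def by (simp add: power2_eq_square)
  hence img: "strip_map \<phi> \<theta> ` periodic_domain \<omega> = horizontal_strip c"
    unfolding strip_map_image horizontal_strip_def by simp
  let ?T = "strip_to_disc c" and ?S = "strip_map \<phi> \<theta>"
  have "is_bergman_kernel (?S ` periodic_domain \<omega>) (\<lambda>z w. deriv ?T z * cnj (deriv ?T w) * disc_kernel (?T z) (?T w))"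
    unfolding img by (rule is_bergman_kernel_strip[OF c])
  from bergman_kernel_eq[OF open_periodic_domain
      is_bergman_kernel_conformal[OF open_periodic_domain strip_map_hol strip_map_inj this] assms(9,10)]
  have "bergman_kernel (periodic_domain \<omega>) z w = deriv ?S z * cnj (deriv ?S w) *
      (deriv ?T (?S z) * cnj (deriv ?T (?S w)) * disc_kernel (?T (?S z)) (?T (?S w)))" .
  also have "deriv ?T (?S z) * cnj (deriv ?T (?S w)) * disc_kernel (?T (?S z)) (?T (?S w)) =
      of_real (c\<^sup>2 / pi) * (sech (of_real c * (?S z - cnj (?S w))))\<^sup>2"
    using img assms(9,10) by (intro strip_kernel_eq[OF c]) blast+
  also have "c\<^sup>2 / pi = pi ^ 3 / (4 * (ln \<rho>)\<^sup>2)"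
    unfolding c_def by (simp add: power2_eq_square power3_eq_cube)
  also have "of_real c * (?S z - cnj (?S w)) = of_real (pi\<^sup>2) * (?S z - cnj (?S w)) / of_real (2 * ln \<rho>)"
    unfolding c_def by simp
  also have "deriv ?S z * cnj (deriv ?S w) = K_tilde \<phi> \<theta> z w"
  proof -
    let ?k = "\<i> * 2 * of_real pi"
    have "cnj (deriv ?S w) = exp (cnj (?k * (w - ?S w))) * cnj (deriv \<phi> (expE w))"
      unfolding deriv_strip_map[OF assms(10)] by (simp only: complex_cnj_mult exp_cnj)
    hence "deriv ?S z * cnj (deriv ?S w) = exp (?k * (z - ?S z) + cnj (?k * (w - ?S w))) *
       deriv \<phi> (expE z) * cnj (deriv \<phi> (expE w))"
      unfolding deriv_strip_map[OF assms(9)] by (simp only: exp_add mult_ac)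
    \<comment> \<open>Conjugation changes the sign of the imaginary factor, hence the signs of the
      terms in w in \<open>K_tilde\<close>.\<close>
    also have "?k * (z - ?S z) + cnj (?k * (w - ?S w)) = ?k * (z - ?S z - cnj w + cnj (?S w))"
      by (simp add: algebra_simps)
    finally show ?thesis unfolding K_tilde_def .
  qed
  finally show ?thesis by (simp only: mult.assoc)
qed

end
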